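(* Let $p$ be a prime and $r\ge 1$ an integer. Let $\mathcal{C}$ be a free convolutional code over $\mathbb{Z}_{p^r}$ and let $\mathcal{C}^\perp$ be its dual code. Then $$\Delta_p(\mathcal{C})=\Delta_p(\mathcal{C}^\perp).$$
   Context: $\mathbb{Z}_{p^r}=\mathbb{Z}/p^r\mathbb{Z}$; $a\mapsto\overline{a}$ denotes reduction modulo $p$ onto $\mathbb{F}_p$, extended coefficientwise to polynomials, Laurent series and matrices. $\mathbb{Z}_{p^r}((D))$ is the ring of formal Laurent series in $D$ (finitely many negative powers of $D$). A free convolutional code $\mathcal{C}$ of length $n$ and rank $k$ over $\mathbb{Z}_{p^r}$ is a free submodule of $\mathbb{Z}_{p^r}((D))^n$ of rank $k$ generated by the rows of a $k\times n$ polynomial matrix $G(D)\in\mathbb{Z}_{p^r}[D]^{k\times n}$ of full rank (rows linearly independent over $\mathbb{Z}_{p^r}((D))$), i.e. $\mathcal{C}=\{\mathbf{u}(D)G(D) : \mathbf{u}(D)\in\mathbb{Z}_{p^r}((D))^k\}$. Such a $G(D)$ is called a generator matrix (or encoder) of $\mathcal{C}$. Two generator matrices in $\mathbb{Z}_{p^r}[D]^{k\times n}$ are equivalent if they generate the same code. The dual code of $\mathcal{C}$ is $\mathcal{C}^\perp=\{\mathbf{v}(D)\in\mathbb{Z}_{p^r}((D))^n : \mathbf{v}(D)\cdot\mathbf{w}(D)^T=0 \text{ for all } \mathbf{w}(D)\in\mathcal{C}\}$; it is a known fact that it is a free convolutional code of length $n$ and rank $n-k$, so it admits a polynomial generator matrix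 $H(D)\in\mathbb{Z}_{p^r}[D]^{(n-k)\times n}$. The internal degree of a generator matrix $G(D)$ of a rank $k$ code is the maximum of the degrees of all $k\times k$ minors of $G(D)$. A generator matrix $G(D)$ is a reduced internal degree matrix (RIDM) if its internal degree is minimal among all polynomial generator matrices equivalent to $G(D)$. For a RIDM $G(D)$, $\Delta_p(G)\in\mathbb{F}_p[D]$ is the (monic) greatest common divisor in $\mathbb{F}_p[D]$ of the $k\times k$ minors of $\overline{G}(D)\in\mathbb{F}_p[D]^{k\times n}$ (for a code of rank $0$ the only minor is the empty determinant $1$). The residual structural polynomial of a free code $\mathcal{C}$ of rank $k$ is $\Delta_p(\mathcal{C})=\Delta_p(G)$, where $G(D)$ is any RIDM generator matrix of $\mathcal{C}$ (the value is independent of the choice of RIDM); $\Delta_p(\mathcal{C}^\perp)$ is defined in the same way, with $n-k$ in place of $k$. *)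

theory Defs
  imports
    "HOL-Computational_Algebra.Formal_Laurent_Series"
    "HOL-Computational_Algebra.Polynomial_FPS"
    "HOL-Computational_Algebra.Polynomial_Factorial"
    "Jordan_Normal_Form.Determinant"
    "Jordan_Normal_Form.DL_Submatrix"
    "Berlekamp_Zassenhaus.Finite_Field"
begin

text \<open>The ring of integers modulo \<^term>\<open>p ^ r\<close> is the type \<^typ>\<open>'q mod_ring\<close> with
  \<^term>\<open>CARD('q) = p ^ r\<close>, and the prime field with \<^term>\<open>p\<close> elements is \<^typ>\<open>'p mod_ring\<close>
  with \<^term>\<open>CARD('p) = p\<close>. Vectors are row vectors.\<close>

definition fls_of_poly :: "'a::comm_ring_1 poly \<Rightarrow> 'a fls" where
  "fls_of_poly f = fps_to_fls (fps_of_poly f)"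

text \<open>The row vector \<open>u G\<close>, written as the transpose of \<open>G\<close> applied to \<open>u\<close>.\<close>

definition encode :: "'a::comm_ring_1 poly mat \<Rightarrow> 'a fls vec \<Rightarrow> 'a fls vec" where
  "encode G u = transpose_mat (map_mat fls_of_poly G) *\<^sub>v u"

definition full_row_rank :: "'a::comm_ring_1 poly mat \<Rightarrow> bool" where
  "full_row_rank G \<longleftrightarrow>
     (\<forall>u \<in> carrier_vec (dim_row G). encode G u = 0\<^sub>v (dim_col G) \<longrightarrow> u = 0\<^sub>v (dim_row G))"

definition row_code :: "'a::comm_ring_1 poly mat \<Rightarrow> 'a fls vec set" where
  "row_code G = encode G ` carrier_vec (dim_row G)"

definition generator_matrix ::
  "nat \<Rightarrow> nat \<Rightarrow> 'a::comm_ring_1 fls vec set \<Rightarrow> 'a poly mat \<Rightarrow> bool" where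
  "generator_matrix k n C G \<longleftrightarrow> G \<in> carrier_mat k n \<and> full_row_rank G \<and> C = row_code G"

text \<open>Length \<open>n\<close>, rank \<open>k\<close>. The rows of a generator matrix are a basis, so freeness is implied.\<close>

definition free_convolutional_code :: "nat \<Rightarrow> nat \<Rightarrow> 'a::comm_ring_1 fls vec set \<Rightarrow> bool" where
  "free_convolutional_code k n C \<longleftrightarrow> (\<exists>G. generator_matrix k n C G)"

definition dual_code :: "nat \<Rightarrow> 'a::comm_ring_1 fls vec set \<Rightarrow> 'a fls vec set" where
  "dual_code n C = {v \<in> carrier_vec n. \<forall>w \<in> C. v \<bullet> w = 0}"

text \<open>The minors using all rows. If \<open>G\<close> has no rows, the only one is the empty determinant \<open>1\<close>.\<close>

definition maximal_minors :: "'a::comm_ring_1 mat \<Rightarrow> 'a set" where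
  "maximal_minors G =
     {det (submatrix G UNIV J) | J. J \<subseteq> {..<dim_col G} \<and> card J = dim_row G}"

definition internal_degree :: "'a::comm_ring_1 poly mat \<Rightarrow> nat" where
  "internal_degree G = Max (degree ` maximal_minors G)"

definition RIDM :: "nat \<Rightarrow> nat \<Rightarrow> 'a::comm_ring_1 fls vec set \<Rightarrow> 'a poly mat \<Rightarrow> bool" where
  "RIDM k n C G \<longleftrightarrow> generator_matrix k n C G \<and>
     (\<forall>G'. generator_matrix k n C G' \<longrightarrow> internal_degree G \<le> internal_degree G')"

text \<open>Reduction via the least nonnegative representative; a ring homomorphism when
  \<^term>\<open>CARD('p)\<close> divides \<^term>\<open>CARD('q)\<close>.\<close>

definition reduce_mod :: "'q::nontriv mod_ring \<Rightarrow> 'p::prime_card mod_ring" where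
  "reduce_mod a = of_int_mod_ring (to_int_mod_ring a)"

definition reduce_mat :: "'q::nontriv mod_ring poly mat \<Rightarrow> 'p::prime_card mod_ring poly mat" where
  "reduce_mat G = map_mat (map_poly reduce_mod) G"

text \<open>\<^const>\<open>Gcd\<close> on polynomials over a field is normalised, i.e.\ monic or zero.\<close>

definition Delta_matrix :: "'q::nontriv mod_ring poly mat \<Rightarrow> 'p::prime_card mod_ring poly" where
  "Delta_matrix G = Gcd (maximal_minors (reduce_mat G))"

lemma lead_coeff_Delta_matrix:
  assumes "Delta_matrix G \<noteq> (0 :: 'p::prime_card mod_ring poly)"
  shows "lead_coeff (Delta_matrix G :: 'p mod_ring poly) = 1"
proof -
  let ?d = "Delta_matrix G :: 'p mod_ring poly"
  have "unit_factor (normalize ?d) = 1"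
    using assms by (rule unit_factor_normalize)
  moreover have "normalize ?d = ?d"
    unfolding Delta_matrix_def by (rule normalize_Gcd)
  ultimately have "[:unit_factor (lead_coeff ?d):] = [:1:]"
    by (simp only: unit_factor_poly_def one_pCons)
  then have "unit_factor (lead_coeff ?d) = 1"
    by (simp only: pCons_eq_iff)
  then show ?thesis
    by (simp only: unit_factor_mod_ring_def)
qed

text \<open>The residual structural polynomial of a code of length \<open>n\<close> and rank \<open>k\<close>: the common value
  of \<^const>\<open>Delta_matrix\<close> on its reduced internal degree matrices.\<close>

definition Delta_code ::
  "nat \<Rightarrow> nat \<Rightarrow> 'q::nontriv mod_ring fls vec set \<Rightarrow> 'p::prime_card mod_ring poly" where
  "Delta_code k n C = (THE d. \<exists>G. RIDM k n C G \<and> d = Delta_matrix G)"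

end

theory Submission
  imports Defs
begin

text \<open>
  Fix a column set \<open>J\<close> for which the \<open>J\<close>-minor of an encoder \<open>G\<close> of \<open>C\<close> is nonzero modulo \<open>p\<close>. Writing
  \<open>G = [X | Y]\<close> along \<open>J\<close> and its complement, encoders of the dual code are the \<open>[-A\<^sup>T | Z\<^sup>T]\<close>
  with \<open>Y Z = X A\<close>, that is, right fractions of \<open>X\<^sup>-\<^sup>1 Y\<close>. Every left fraction can be rewritten as a
  right fraction such that \<open>det Z\<close> divides \<open>det X\<close> modulo \<open>p\<close>, and two encoders of the same code admit
  one whose \<open>J\<close>-minor divides both of theirs modulo \<open>p\<close>. Hence, if the residual degrees of the
  \<open>J\<close>-minor of \<open>G\<close> and of the complementary minor of \<open>H\<close> are both minimal, these two minors are
  associated modulo \<open>p\<close>. Complementary minors of \<open>G\<close> and \<open>H\<close> are proportional up to sign, so the gcds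
  of all maximal minors agree as well. Finally, a RIDM has \<open>J\<close>-minor of minimal residual degree:
  by Weierstrass preparation the minor is a unit times a monic polynomial, and trading it for one of
  smaller degree lowers the degree of all minors.
\<close>

hide_const (open) UnivPoly.coeff UnivPoly.monom Module.smult

section \<open>Unimodular column reduction\<close>

text \<open>For r > 1 the polynomials over Z/p^r are not a Euclidean ring and have zero divisors, so
  matrices cannot be reduced there and degrees of minors need not add. Every Euclidean argument is
  run over F_p[D] and lifted; the error, a multiple of p, is removed by nilpotency. A minor is
  nonzero modulo p exactly when it becomes a unit among Laurent series, which is why one
  \<open>J\<close> serves all encoders of the code and its complement serves the dual. The field
  case does not apply to the reductions themselves, because a common factor modulo p need not
  cancel. Over Z/4 take the encoder (1+D, 3+D). Its entries differ by 2, so if u (1+D, 3+D) is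
  polynomial, then so are 2u and the reduction of u, and 1+D divides the reductions of both entries
  of every encoder. What is compared is therefore the least residual degree attainable at
  \<open>J\<close>. The internal degree is measured over Z/p^r and may exceed the residual one
  through nilpotent leading coefficients; Weierstrass preparation bridges the two.\<close>

definition unimodular_pair :: "nat \<Rightarrow> 'a::comm_ring_1 mat \<Rightarrow> 'a mat \<Rightarrow> bool" where
  "unimodular_pair n U V \<longleftrightarrow>
     U \<in> carrier_mat n n \<and> V \<in> carrier_mat n n \<and> U * V = 1\<^sub>m n \<and> V * U = 1\<^sub>m n"

lemma unimodular_pair_one: "unimodular_pair n (1\<^sub>m n) (1\<^sub>m n)"
  by (simp add: unimodular_pair_def)

lemma unimodular_pair_mult:
  assumes "unimodular_pair n U V" "unimodular_pair n U' V'"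
  shows "unimodular_pair n (U * U') (V' * V)"
proof -
  from assms have c: "U \<in> carrier_mat n n" "V \<in> carrier_mat n n"
    "U' \<in> carrier_mat n n" "V' \<in> carrier_mat n n"
    and e: "U * V = 1\<^sub>m n" "V * U = 1\<^sub>m n" "U' * V' = 1\<^sub>m n" "V' * U' = 1\<^sub>m n"
    by (auto simp: unimodular_pair_def)
  have "U * U' * (V' * V) = U * (U' * V') * V"
    using c by (simp add: assoc_mult_mat[of _ n n _ n _ n])
  then have 1: "U * U' * (V' * V) = 1\<^sub>m n" using c e by simp
  have "V' * V * (U * U') = V' * (V * U) * U'"
    using c by (simp add: assoc_mult_mat[of _ n n _ n _ n])
  then have 2: "V' * V * (U * U') = 1\<^sub>m n" using c e by simp
  show ?thesis using 1 2 c by (simp add: unimodular_pair_def)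
qed

lemma unimodular_pair_det_dvd_1:
  assumes "unimodular_pair n U V"
  shows "det U dvd 1"
proof -
  have "det U * det V = 1"
    using assms unfolding unimodular_pair_def by (metis det_mult det_one)
  then show ?thesis by (metis dvd_triv_left)
qed

lemma unimodular_pair_addrow:
  assumes "l < n" "j < n" "j \<noteq> l"
  shows "unimodular_pair n (addrow_mat n a l j) (addrow_mat n (- a :: 'a::comm_ring_1) l j)"
  using assms addrow_mat_inv[of l n j a] addrow_mat_inv[of l n j "-a"]
  by (auto simp: unimodular_pair_def)

lemma unimodular_pair_swaprows:
  assumes "l < n" "j < n"
  shows "unimodular_pair n (swaprows_mat n l j) (swaprows_mat n l j :: 'a::comm_ring_1 mat)"
  using assms swaprows_mat_inv by (auto simp: unimodular_pair_def)

text \<open>A minimality argument in place of a Euclidean algorithm: among all unimodular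
  \<open>U\<close> take one with the least total Euclidean size of the first row of
  \<open>M * U\<close>. Two nonzero entries there would allow one more division with
  remainder.\<close>

lemma ex_unimodular_clear_row:
  fixes M :: "'a::euclidean_ring mat"
  assumes M: "M \<in> carrier_mat k n" and k: "0 < k"
  shows "\<exists>U V. unimodular_pair n U V \<and> (\<forall>j<n. 0 < j \<longrightarrow> (M * U) $$ (0, j) = 0)"
proof -
  define \<mu> where "\<mu> N = (\<Sum>j<n. euclidean_size (N $$ (0, j)))" for N :: "'a mat"
  obtain U V where UV: "unimodular_pair n U V"
    and minimal: "\<And>U' V'. unimodular_pair n U' V' \<Longrightarrow> \<mu> (M * U) \<le> \<mu> (M * U')"
    using ex_has_least_nat[of "\<lambda>U. \<exists>V. unimodular_pair n U V" "1\<^sub>m n" "\<lambda>U. \<mu> (M * U)"]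
      unimodular_pair_one[of n] by metis
  define N where "N = M * U"
  have U: "U \<in> carrier_mat n n" using UV by (simp add: unimodular_pair_def)
  have N: "N \<in> carrier_mat k n" using M U by (simp add: N_def)
  have reducible: False
    if jl: "j < n" "l < n" "j \<noteq> l" "N $$ (0, l) \<noteq> 0"
      and le: "euclidean_size (N $$ (0, l)) \<le> euclidean_size (N $$ (0, j))" for j l
  proof -
    \<comment> \<open>Adding \<open>q\<close> times column \<open>l\<close> to column
      \<open>j\<close> replaces the entry at \<open>j\<close> by its remainder modulo the entry at
      \<open>l\<close>, whose size is below that of both entries.\<close>
    define q where "q = - (N $$ (0, j) div N $$ (0, l))"
    let ?E = "addrow_mat n q l j"
    have "unimodular_pair n (U * ?E) (addrow_mat n (- q) l j * V)"
      using UV unimodular_pair_addrow[of l n j q] jl by (blast intro: unimodular_pair_mult)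
    then have "\<mu> N \<le> \<mu> (M * (U * ?E))" unfolding N_def by (rule minimal)
    also have "M * (U * ?E) = addcol q j l N"
      using M U jl by (simp add: N_def addcol_mat[of _ k n] assoc_mult_mat[of _ k n _ n _ n])
    also have "\<mu> (addcol q j l N) < \<mu> N"
      unfolding \<mu>_def
    proof (rule sum_strict_mono_ex1)
      have "q * N $$ (0, l) + N $$ (0, j) = N $$ (0, j) mod N $$ (0, l)"
        by (simp add: q_def algebra_simps flip: minus_div_mult_eq_mod)
      then have at_j: "addcol q j l N $$ (0, j) = N $$ (0, j) mod N $$ (0, l)"
        using N k jl by simp
      have lt: "euclidean_size (addcol q j l N $$ (0, j)) < euclidean_size (N $$ (0, j))"
        unfolding at_j using mod_size_less[OF jl(4)] le by (rule less_le_trans)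
      then show "\<exists>i\<in>{..<n}. euclidean_size (addcol q j l N $$ (0, i)) < euclidean_size (N $$ (0, i))"
        using jl by blast
      show "\<forall>i\<in>{..<n}. euclidean_size (addcol q j l N $$ (0, i)) \<le> euclidean_size (N $$ (0, i))"
      proof
        fix i assume "i \<in> {..<n}"
        then show "euclidean_size (addcol q j l N $$ (0, i)) \<le> euclidean_size (N $$ (0, i))"
          using N k lt by (cases "i = j") auto
      qed
    qed simp
    finally show False by simp
  qed
  have unique: "j = l" if "j < n" "l < n" "N $$ (0, j) \<noteq> 0" "N $$ (0, l) \<noteq> 0" for j l
    using reducible[of j l] reducible[of l j] that
    by (metis nat_le_linear)
  show ?thesis
  proof (cases "\<exists>j<n. N $$ (0, j) \<noteq> 0")
    case False
    then show ?thesis using UV by (auto simp: N_def)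
  next
    case True
    then obtain j where j: "j < n" "N $$ (0, j) \<noteq> 0" by blast
    let ?E = "swaprows_mat n 0 j"
    have "unimodular_pair n (U * ?E) (?E * V)"
      using UV j by (intro unimodular_pair_mult unimodular_pair_swaprows) auto
    moreover have "M * (U * ?E) = swapcols 0 j N"
      using M U j by (simp add: N_def swapcols_mat[of _ k n] assoc_mult_mat[of _ k n _ n _ n])
    moreover have "swapcols 0 j N $$ (0, i) = 0" if i: "i < n" "0 < i" for i
      using i j N k unique[of i j] unique[of 0 j] by auto
    ultimately show ?thesis by metis
  qed
qed

lemma unimodular_pair_four_block:
  assumes "unimodular_pair n U V"
  shows "unimodular_pair (Suc n) (four_block_mat (1\<^sub>m 1) (0\<^sub>m 1 n) (0\<^sub>m n 1) U)
    (four_block_mat (1\<^sub>m 1) (0\<^sub>m 1 n) (0\<^sub>m n 1) V)"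
  using assms four_block_one_mat[of 1 n]
  by (auto simp: unimodular_pair_def mult_four_block_mat[of _ 1 1 _ n _ n _ _ 1 _ n])

text \<open>Once the first row is cleared, the recursion works on the block without the first row
  and column; a block diagonal transformation leaves that row and column intact.\<close>

lemma ex_unimodular_lower_triangular:
  fixes M :: "'a::euclidean_ring mat"
  assumes "M \<in> carrier_mat k n"
  shows "\<exists>U V. unimodular_pair n U V \<and> (\<forall>i<k. \<forall>j<n. i < j \<longrightarrow> (M * U) $$ (i, j) = 0)"
  using assms
proof (induction k arbitrary: n M)
  case 0
  then show ?case using unimodular_pair_one by blast
next
  case (Suc k)
  show ?case
  proof (cases n)
    case 0
    then show ?thesis using unimodular_pair_one by blast
  next
    case n: (Suc n')
    from ex_unimodular_clear_row[OF Suc.prems] obtain U V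
      where UV: "unimodular_pair n U V" and clear: "\<And>j. j < n \<Longrightarrow> 0 < j \<Longrightarrow> (M * U) $$ (0, j) = 0"
      by auto
    have U: "U \<in> carrier_mat n n" using UV by (simp add: unimodular_pair_def)
    have MU: "M * U \<in> carrier_mat (Suc k) n" using Suc.prems U by simp
    define a where "a = mat 1 1 (\<lambda>_. (M * U) $$ (0, 0))"
    define c where "c = mat k 1 (\<lambda>(i, j). (M * U) $$ (Suc i, 0))"
    define M' where "M' = mat k n' (\<lambda>(i, j). (M * U) $$ (Suc i, Suc j))"
    have carr: "a \<in> carrier_mat 1 1" "c \<in> carrier_mat k 1" "M' \<in> carrier_mat k n'"
      by (simp_all add: a_def c_def M'_def)
    have block: "M * U = four_block_mat a (0\<^sub>m 1 n') c M'"
      using MU by (intro eq_matI) (auto simp: a_def c_def M'_def n clear)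
    from Suc.IH[OF carr(3)] obtain U' V' where UV': "unimodular_pair n' U' V'"
      and tri: "\<And>i j. i < k \<Longrightarrow> j < n' \<Longrightarrow> i < j \<Longrightarrow> (M' * U') $$ (i, j) = 0"
      by blast
    have U': "U' \<in> carrier_mat n' n'" using UV' by (simp add: unimodular_pair_def)
    let ?E = "four_block_mat (1\<^sub>m 1) (0\<^sub>m 1 n') (0\<^sub>m n' 1) U'"
    let ?F = "four_block_mat (1\<^sub>m 1) (0\<^sub>m 1 n') (0\<^sub>m n' 1) V'"
    have "unimodular_pair n (U * ?E) (?F * V)"
      using UV unimodular_pair_four_block[OF UV'] n by (auto intro: unimodular_pair_mult)
    moreover have "M * (U * ?E) = four_block_mat a (0\<^sub>m 1 n') c (M' * U')"
    proof -
      have "?E \<in> carrier_mat n n" using U' n four_block_carrier_mat[of "1\<^sub>m 1" 1 1 U' n' n'] by simp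
      then have "M * (U * ?E) = M * U * ?E"
        using Suc.prems U by (metis assoc_mult_mat)
      also have "\<dots> = four_block_mat a (0\<^sub>m 1 n') c (M' * U')"
        unfolding block using carr U'
        by (simp add: mult_four_block_mat[of _ 1 1 _ n' _ k _ _ 1 _ n'])
      finally show ?thesis .
    qed
    moreover have "four_block_mat a (0\<^sub>m 1 n') c (M' * U') $$ (i, j) = 0"
      if "i < Suc k" "j < n" "i < j" for i j
      using that carr U' n tri[of "i - 1" "j - 1"] by (cases i) auto
    ultimately show ?thesis by metis
  qed
qed

lemma four_block_mat_exhaust:
  assumes "A \<in> carrier_mat (k + m) (l + n)"
  obtains A1 A2 A3 A4 where "A = four_block_mat A1 A2 A3 A4"
    "A1 \<in> carrier_mat k l" "A2 \<in> carrier_mat k n" "A3 \<in> carrier_mat m l" "A4 \<in> carrier_mat m n"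
proof -
  obtain A1 A2 A3 A4 where "split_block A k l = (A1, A2, A3, A4)"
    by (metis prod_cases4)
  from split_block[OF this] assms that show thesis by auto
qed

lemma four_block_mat_upper_eqD:
  assumes eq: "four_block_mat A B C D = four_block_mat A' B' C' D'"
    and "A \<in> carrier_mat k l" "B \<in> carrier_mat k n" "C \<in> carrier_mat m l" "D \<in> carrier_mat m n"
    and "A' \<in> carrier_mat k l" "B' \<in> carrier_mat k n" "C' \<in> carrier_mat m l" "D' \<in> carrier_mat m n"
  shows "A = A'" "B = B'"
proof -
  have ix: "four_block_mat A B C D $$ (i, j) = four_block_mat A' B' C' D' $$ (i, j)" for i j
    by (simp only: eq)
  show "A = A'"
  proof (rule eq_matI)
    fix i j assume "i < dim_row A'" "j < dim_col A'"
    then show "A $$ (i, j) = A' $$ (i, j)" using ix[of i j] assms(2-) by simp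
  qed (use assms in auto)
  show "B = B'"
  proof (rule eq_matI)
    fix i j assume "i < dim_row B'" "j < dim_col B'"
    then show "B $$ (i, j) = B' $$ (i, j)" using ix[of i "j + l"] assms(2-) by simp
  qed (use assms in auto)
qed

text \<open>\<open>N\<close> is a greatest common left divisor of \<open>X\<close> and
  \<open>Y\<close> with Bezout coefficients \<open>U1\<close>, \<open>U3\<close>, while
  \<open>U2\<close>, \<open>U4\<close> form, up to sign, a right fraction for the same quotient. The
  last conclusion says that the denominator \<open>U4\<close> keeps only what remains of
  \<open>det X\<close> after \<open>N\<close> has been split off.\<close>

lemma ex_block_column_reduction:
  fixes X Y :: "'a::euclidean_ring mat"
  assumes X: "X \<in> carrier_mat k k" and Y: "Y \<in> carrier_mat k m"
  obtains U1 U2 U3 U4 V1 V2 N where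
    "U1 \<in> carrier_mat k k" "U2 \<in> carrier_mat k m" "U3 \<in> carrier_mat m k" "U4 \<in> carrier_mat m m"
    "V1 \<in> carrier_mat k k" "V2 \<in> carrier_mat k m" "N \<in> carrier_mat k k"
    "N = X * U1 + Y * U3" "X * U2 + Y * U4 = 0\<^sub>m k m" "X = N * V1" "Y = N * V2"
    "det U4 * det N dvd det X"
proof -
  \<comment> \<open>Padding by an identity makes the wide matrix \<open>(X Y)\<close> square, so
    that determinants can be compared; the lower rows of \<open>P * U\<close> are those of
    \<open>U\<close>.\<close>
  define P where "P = four_block_mat X Y (0\<^sub>m m k) (1\<^sub>m m)"
  have P: "P \<in> carrier_mat (k + m) (k + m)" using X Y by (simp add: P_def)
  obtain U V where UV: "unimodular_pair (k + m) U V"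
    and tri: "\<And>i j. i < k + m \<Longrightarrow> j < k + m \<Longrightarrow> i < j \<Longrightarrow> (P * U) $$ (i, j) = 0"
    using ex_unimodular_lower_triangular[OF P] by blast
  have U: "U \<in> carrier_mat (k + m) (k + m)" and V: "V \<in> carrier_mat (k + m) (k + m)"
    and UV1: "U * V = 1\<^sub>m (k + m)"
    using UV by (auto simp: unimodular_pair_def)
  obtain U1 U2 U3 U4 where Ub: "U = four_block_mat U1 U2 U3 U4"
    and Uc: "U1 \<in> carrier_mat k k" "U2 \<in> carrier_mat k m" "U3 \<in> carrier_mat m k" "U4 \<in> carrier_mat m m"
    using U by (rule four_block_mat_exhaust)
  obtain V1 V2 V3 V4 where Vb: "V = four_block_mat V1 V2 V3 V4"
    and Vc: "V1 \<in> carrier_mat k k" "V2 \<in> carrier_mat k m" "V3 \<in> carrier_mat m k" "V4 \<in> carrier_mat m m"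
    using V by (rule four_block_mat_exhaust)
  define N where "N = X * U1 + Y * U3"
  have N: "N \<in> carrier_mat k k" using X Y Uc by (simp add: N_def)
  have PU: "P * U = four_block_mat N (X * U2 + Y * U4) U3 U4"
    unfolding P_def Ub N_def using X Y Uc
    by (simp add: mult_four_block_mat[of _ k k _ m _ m _ _ k _ m])
  have R0: "X * U2 + Y * U4 = 0\<^sub>m k m"
  proof (rule eq_matI)
    fix i j assume ij: "i < dim_row (0\<^sub>m k m)" "j < dim_col (0\<^sub>m k m)"
    have "(P * U) $$ (i, j + k) = 0" using ij by (intro tri) auto
    then show "(X * U2 + Y * U4) $$ (i, j) = 0\<^sub>m k m $$ (i, j)"
      unfolding PU using ij N X Y Uc by simp
  qed (use X Y Uc in auto)
  have PU: "P * U = four_block_mat N (0\<^sub>m k m) U3 U4" using PU R0 by simp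
  have "det X * det U = det (P * U)"
    unfolding det_mult[OF P U] using X Y by (simp add: P_def det_four_block_mat_lower_left_zero)
  also have "\<dots> = det N * det U4"
    unfolding PU using N Uc by (simp add: det_four_block_mat_upper_right_zero)
  finally have "det U4 * det N = det X * det U" by (simp add: mult.commute)
  then have dvd: "det U4 * det N dvd det X"
    using unimodular_pair_det_dvd_1[OF UV] by (metis dvd_refl mult_dvd_mono mult_1_right)
  \<comment> \<open>The explicit inverse \<open>V\<close> leads back from \<open>P * U\<close> to
    \<open>P\<close>; as the upper right block of \<open>P * U\<close> is zero, \<open>X\<close> and
    \<open>Y\<close> come out as right multiples of \<open>N\<close>.\<close>
  have "P = P * U * V"
    using P U V UV1 by (simp add: assoc_mult_mat[of _ "k + m" "k + m" _ "k + m" _ "k + m"])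
  also have "\<dots> = four_block_mat (N * V1) (N * V2) (U3 * V1 + U4 * V3) (U3 * V2 + U4 * V4)"
    unfolding PU Vb using N Uc Vc
    by (simp add: mult_four_block_mat[of _ k k _ m _ m _ _ k _ m])
  finally have eq: "four_block_mat X Y (0\<^sub>m m k) (1\<^sub>m m) = \<dots>" by (simp add: P_def)
  have "X = N * V1" "Y = N * V2"
    using four_block_mat_upper_eqD[OF eq, of k k m m] X Y N Uc Vc by auto
  then show thesis using that Uc Vc N N_def R0 dvd by blast
qed

section \<open>From left to right matrix fractions\<close>

text \<open>The projection onto the quotient by the ideal of \<pi>, described by surjectivity and
  kernel so that one locale serves the coefficients and, through \<open>map_poly\<close>, the
  polynomials.\<close>

locale quotient_hom = comm_ring_hom \<rho> for \<rho> :: "'a::comm_ring_1 \<Rightarrow> 'b::comm_ring_1" +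
  fixes \<pi> :: 'a
  assumes surj: "\<exists>x. \<rho> x = y"
    and kernel: "\<rho> x = 0 \<longleftrightarrow> \<pi> dvd x"
begin

lemma hom_generator: "\<rho> \<pi> = 0"
  by (simp add: kernel)

lemma lift_mat:
  assumes "A \<in> carrier_mat k n"
  obtains B where "B \<in> carrier_mat k n" "map_mat \<rho> B = A"
proof
  let ?B = "map_mat (\<lambda>y. SOME x. \<rho> x = y) A"
  show "?B \<in> carrier_mat k n" using assms by simp
  show "map_mat \<rho> ?B = A"
    using assms someI_ex[OF surj] by (intro eq_matI) auto
qed

lemma map_mat_eq_0D:
  assumes A: "A \<in> carrier_mat k n" and 0: "map_mat \<rho> A = 0\<^sub>m k n"
  obtains B where "B \<in> carrier_mat k n" "A = \<pi> \<cdot>\<^sub>m B"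
proof
  let ?B = "map_mat (\<lambda>x. SOME y. x = \<pi> * y) A"
  show "?B \<in> carrier_mat k n" using A by simp
  show "A = \<pi> \<cdot>\<^sub>m ?B"
  proof (rule eq_matI)
    fix i j assume "i < dim_row (\<pi> \<cdot>\<^sub>m ?B)" "j < dim_col (\<pi> \<cdot>\<^sub>m ?B)"
    then have ij: "i < k" "j < n" using A by auto
    have "\<rho> (A $$ (i, j)) = map_mat \<rho> A $$ (i, j)" using A ij by simp
    also have "\<dots> = 0" using 0 ij by simp
    finally have "\<exists>y. A $$ (i, j) = \<pi> * y" by (simp add: kernel dvd_def)
    from someI_ex[OF this] show "A $$ (i, j) = (\<pi> \<cdot>\<^sub>m ?B) $$ (i, j)" using A ij by simp
  qed (use A in auto)
qed

lemma map_mat_plus: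
  "A \<in> carrier_mat k n \<Longrightarrow> B \<in> carrier_mat k n \<Longrightarrow>
    map_mat \<rho> (A + B) = map_mat \<rho> A + map_mat \<rho> B"
  by (intro eq_matI) (auto simp: hom_add)

lemma map_mat_smult_generator:
  "A \<in> carrier_mat k n \<Longrightarrow> map_mat \<rho> (\<pi> \<cdot>\<^sub>m A) = 0\<^sub>m k n"
  by (intro eq_matI) (auto simp: hom_mult hom_generator)

end

locale euclidean_quotient_hom = quotient_hom \<rho> \<pi>
  for \<rho> :: "'a::comm_ring_1 \<Rightarrow> 'b::euclidean_ring" and \<pi>
begin

text \<open>A left fraction \<open>X\<^sup>-\<^sup>1 Y\<close> is converted into a right fraction \<open>A Z\<^sup>-\<^sup>1\<close>, one power of
  \<open>\<pi>\<close> at a time: a unimodular column reduction of \<open>(X Y)\<close> modulo \<open>\<pi>\<close> gives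
  \<open>(X Y) U = (X\<^sub>1 \<pi>Y\<^sub>1)\<close>, and the induction hypothesis applies to \<open>(X\<^sub>1 Y\<^sub>1)\<close>.\<close>

lemma ex_right_fraction_mod_power:
  assumes "X \<in> carrier_mat k k" "Y \<in> carrier_mat k m"
  shows "\<exists>Z A B. Z \<in> carrier_mat m m \<and> A \<in> carrier_mat k m \<and> B \<in> carrier_mat k m \<and>
    Y * Z = X * A + \<pi> ^ j \<cdot>\<^sub>m B \<and> \<rho> (det Z) dvd \<rho> (det X)"
  using assms
proof (induction j arbitrary: X Y)
  case 0
  show ?case
  proof (intro exI conjI)
    \<comment> \<open>Modulo \<open>\<pi> ^ 0 = 1\<close> every fraction is right, so the trivial
      denominator will do.\<close>
    show "Y * 1\<^sub>m m = X * 0\<^sub>m k m + \<pi> ^ 0 \<cdot>\<^sub>m Y" using 0 by (intro eq_matI) auto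
  qed (use 0 in auto)
next
  case (Suc j)
  note X = Suc.prems(1) and Y = Suc.prems(2)
  have "map_mat \<rho> X \<in> carrier_mat k k" "map_mat \<rho> Y \<in> carrier_mat k m" using X Y by auto
  then obtain u1 u2 u3 u4 N where
    u: "u1 \<in> carrier_mat k k" "u2 \<in> carrier_mat k m" "u3 \<in> carrier_mat m k" "u4 \<in> carrier_mat m m"
    and N: "N = map_mat \<rho> X * u1 + map_mat \<rho> Y * u3"
    and 0: "map_mat \<rho> X * u2 + map_mat \<rho> Y * u4 = 0\<^sub>m k m"
    and dvd: "det u4 * det N dvd det (map_mat \<rho> X)"
    by (rule ex_block_column_reduction)
  \<comment> \<open>The blocks are lifted entry by entry, so the second block column of
    \<open>(X Y) U\<close> vanishes only modulo \<pi>; this is the origin of the factor \<pi> before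
    \<open>Y'\<close>.\<close>
  obtain U1 where U1: "U1 \<in> carrier_mat k k" "map_mat \<rho> U1 = u1" using u(1) by (rule lift_mat)
  obtain U2 where U2: "U2 \<in> carrier_mat k m" "map_mat \<rho> U2 = u2" using u(2) by (rule lift_mat)
  obtain U3 where U3: "U3 \<in> carrier_mat m k" "map_mat \<rho> U3 = u3" using u(3) by (rule lift_mat)
  obtain U4 where U4: "U4 \<in> carrier_mat m m" "map_mat \<rho> U4 = u4" using u(4) by (rule lift_mat)
  define X' where "X' = X * U1 + Y * U3"
  have X': "X' \<in> carrier_mat k k" using X Y U1 U3 by (simp add: X'_def)
  have "map_mat \<rho> (X * U2 + Y * U4) = 0\<^sub>m k m"
    unfolding 0[symmetric] U2(2)[symmetric] U4(2)[symmetric] using X Y U2(1) U4(1)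
    by (simp add: map_mat_plus[of _ k m] mat_hom_mult[of _ k k _ m] mat_hom_mult[of _ k m _ m])
  moreover have "X * U2 + Y * U4 \<in> carrier_mat k m" using X Y U2 U4 by simp
  ultimately obtain Y' where Y': "Y' \<in> carrier_mat k m" and eY': "X * U2 + Y * U4 = \<pi> \<cdot>\<^sub>m Y'"
    by (metis map_mat_eq_0D)
  have NX': "map_mat \<rho> X' = N"
    unfolding X'_def N U1(2)[symmetric] U3(2)[symmetric] using X Y U1(1) U3(1)
    by (simp add: map_mat_plus[of _ k k] mat_hom_mult[of _ k k _ k] mat_hom_mult[of _ k m _ k])
  obtain Z A B where ZAB: "Z \<in> carrier_mat m m" "A \<in> carrier_mat k m" "B \<in> carrier_mat k m"
    and eq: "Y' * Z = X' * A + \<pi> ^ j \<cdot>\<^sub>m B" and dvd': "\<rho> (det Z) dvd \<rho> (det X')"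
    using Suc.IH[OF X' Y'] by blast
  define a where "a = X * (U1 * A)"
  define b where "b = Y * (U3 * A)"
  define c where "c = X * (U2 * Z)"
  define d where "d = Y * (U4 * Z)"
  have carr: "a \<in> carrier_mat k m" "b \<in> carrier_mat k m" "c \<in> carrier_mat k m" "d \<in> carrier_mat k m"
    using X Y U1 U2 U3 U4 ZAB by (simp_all add: a_def b_def c_def d_def)
  have "c + d = (X * U2 + Y * U4) * Z"
    using X Y U2(1) U4(1) ZAB
    by (simp add: c_def d_def add_mult_distrib_mat[of _ k m _ _ m]
        assoc_mult_mat[of _ k k _ m _ m] assoc_mult_mat[of _ k m _ m _ m])
  also have "\<dots> = \<pi> \<cdot>\<^sub>m (Y' * Z)"
    unfolding eY' using Y' ZAB by (simp add: mult_smult_assoc_mat[of _ k m _ m])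
  also have "\<dots> = \<pi> \<cdot>\<^sub>m (a + b + \<pi> ^ j \<cdot>\<^sub>m B)"
    unfolding eq X'_def a_def b_def using X Y U1(1) U3(1) ZAB
    by (simp add: add_mult_distrib_mat[of _ k k _ _ m]
        assoc_mult_mat[of _ k k _ k _ m] assoc_mult_mat[of _ k m _ k _ m])
  finally have key: "c + d = \<pi> \<cdot>\<^sub>m (a + b + \<pi> ^ j \<cdot>\<^sub>m B)" .
  have keyix: "c $$ (i, l) + d $$ (i, l) =
      \<pi> * (a $$ (i, l) + b $$ (i, l) + \<pi> ^ j * B $$ (i, l))" if "i < k" "l < m" for i l
    using arg_cong[OF key, of "\<lambda>M. M $$ (i, l)"] that carr ZAB by (simp add: add.assoc)
  \<comment> \<open>\<open>-A'\<close> and \<open>Z'\<close> are the upper and lower block of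
    \<open>U\<close> applied to the column with blocks \<open>-\<pi> A\<close> and \<open>Z\<close>.
    Since \<open>(X Y) U = (X' \<pi>Y')\<close>, applying \<open>(X Y)\<close> to the result leaves
    \<pi> times the old error.\<close>
  define Z' where "Z' = U4 * Z - \<pi> \<cdot>\<^sub>m (U3 * A)"
  define A' where "A' = \<pi> \<cdot>\<^sub>m (U1 * A) - U2 * Z"
  have YZ': "Y * Z' = d - \<pi> \<cdot>\<^sub>m b"
    unfolding Z'_def d_def b_def using Y U3(1) U4(1) ZAB
    by (simp add: mult_minus_distrib_mat[of _ k m _ m] mult_smult_distrib[of _ k m _ m])
  have XA': "X * A' = \<pi> \<cdot>\<^sub>m a - c"
    unfolding A'_def c_def a_def using X U1(1) U2(1) ZAB
    by (simp add: mult_minus_distrib_mat[of _ k k _ m] mult_smult_distrib[of _ k k _ m])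
  have "Y * Z' = X * A' + \<pi> ^ Suc j \<cdot>\<^sub>m B"
    unfolding YZ' XA'
  proof (rule eq_matI)
    fix i l assume "i < dim_row (\<pi> \<cdot>\<^sub>m a - c + \<pi> ^ Suc j \<cdot>\<^sub>m B)" "l < dim_col (\<pi> \<cdot>\<^sub>m a - c + \<pi> ^ Suc j \<cdot>\<^sub>m B)"
    then have il: "i < k" "l < m" using ZAB by auto
    show "(d - \<pi> \<cdot>\<^sub>m b) $$ (i, l) = (\<pi> \<cdot>\<^sub>m a - c + \<pi> ^ Suc j \<cdot>\<^sub>m B) $$ (i, l)"
      using keyix[OF il] carr ZAB il by (simp add: algebra_simps)
  qed (use carr ZAB in auto)
  moreover have "\<rho> (det Z') dvd \<rho> (det X)"
  proof -
    \<comment> \<open>Modulo \<pi> the correction term disappears and the determinant gets the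
      factor \<open>det u4\<close>; the induction hypothesis bounds the other factor by
      \<open>det N\<close>, as \<open>X'\<close> lifts \<open>N\<close>.\<close>
    have "map_mat \<rho> Z' = u4 * map_mat \<rho> Z"
    proof -
      have "map_mat \<rho> Z' = map_mat \<rho> (U4 * Z) - map_mat \<rho> (\<pi> \<cdot>\<^sub>m (U3 * A))"
        using U3 U4 ZAB by (intro eq_matI) (auto simp: Z'_def hom_minus)
      also have "map_mat \<rho> (\<pi> \<cdot>\<^sub>m (U3 * A)) = 0\<^sub>m m m"
        using U3(1) ZAB by (intro map_mat_smult_generator) simp
      also have "map_mat \<rho> (U4 * Z) = u4 * map_mat \<rho> Z"
        using U4 ZAB by (simp add: mat_hom_mult[of _ m m _ m])
      finally show ?thesis using u ZAB by (intro eq_matI) auto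
    qed
    then have "\<rho> (det Z') = det u4 * \<rho> (det Z)"
      using u ZAB by (simp flip: hom_det add: det_mult)
    also have "\<dots> dvd det u4 * det N" using dvd' NX' by (simp flip: hom_det add: mult_dvd_mono)
    also have "\<dots> dvd \<rho> (det X)" using dvd by simp
    finally show ?thesis .
  qed
  moreover have "Z' \<in> carrier_mat m m" "A' \<in> carrier_mat k m"
    using U1(1) U2(1) U3(1) U4(1) ZAB
    by (auto simp: Z'_def A'_def intro!: minus_carrier_mat)
  ultimately show ?case using ZAB(3) by blast
qed

text \<open>At \<open>j = r\<close> the error term is zero: nilpotency turns the approximation into
  an exact fraction.\<close>

lemma ex_right_fraction:
  assumes "\<pi> ^ r = 0" "X \<in> carrier_mat k k" "Y \<in> carrier_mat k m"
  obtains Z A where "Z \<in> carrier_mat m m" "A \<in> carrier_mat k m" "Y * Z = X * A"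
    "\<rho> (det Z) dvd \<rho> (det X)"
proof -
  obtain Z A B where *: "Z \<in> carrier_mat m m" "A \<in> carrier_mat k m" "B \<in> carrier_mat k m"
    "Y * Z = X * A + \<pi> ^ r \<cdot>\<^sub>m B" "\<rho> (det Z) dvd \<rho> (det X)"
    using ex_right_fraction_mod_power[OF assms(2,3)] by blast
  have "X * A + \<pi> ^ r \<cdot>\<^sub>m B = X * A"
    using assms * by (intro eq_matI) auto
  with * that show thesis by metis
qed

end

section \<open>Maximal minors\<close>

lemma det_permute_columns:
  assumes A: "A \<in> carrier_mat n n" and p: "p permutes {0..<n}"
  shows "det (mat n n (\<lambda>(i, j). A $$ (i, p j))) = signof p * det A"
proof -
  have "mat n n (\<lambda>(i, j). A $$ (i, p j)) =
      transpose_mat (mat n n (\<lambda>(i, j). transpose_mat A $$ (p i, j)))"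
    using A permutes_in_image[OF p] by (intro eq_matI) auto
  then have "det (mat n n (\<lambda>(i, j). A $$ (i, p j))) =
      det (mat n n (\<lambda>(i, j). transpose_mat A $$ (p i, j)))"
    by (metis det_transpose mat_carrier)
  also have "\<dots> = signof p * det A"
    using A p by (subst det_permute_rows[of _ n]) (auto simp: det_transpose)
  finally show ?thesis .
qed

lemma bij_betw_pick:
  assumes "finite J"
  shows "bij_betw (pick J) {..<card J} J"
proof -
  have inj: "inj_on (pick J) {..<card J}"
    by (rule linorder_inj_onI') (auto dest: pick_mono_le[of _ J])
  moreover have "pick J ` {..<card J} \<subseteq> J" using pick_in_set_le by auto
  ultimately have "pick J ` {..<card J} = J"
    using assms by (intro card_subset_eq) (auto simp: card_image)
  with inj show ?thesis by (simp add: bij_betw_def)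
qed

lemma submatrix_columns_carrier:
  assumes "A \<in> carrier_mat k n" "J \<subseteq> {..<n}"
  shows "submatrix A UNIV J \<in> carrier_mat k (card J)"
proof -
  have "{j. j < n \<and> j \<in> J} = J" using assms by auto
  then show ?thesis using assms by (auto simp: dim_submatrix)
qed

lemma submatrix_columns_index:
  assumes "A \<in> carrier_mat k n" "J \<subseteq> {..<n}" "i < k" "l < card J"
  shows "submatrix A UNIV J $$ (i, l) = A $$ (i, pick J l)"
proof -
  have "{j. j < n \<and> j \<in> J} = J" using assms by auto
  then show ?thesis using assms by (subst submatrix_index) (auto simp: pick_UNIV)
qed

lemma pick_lt:
  assumes "J \<subseteq> {..<n}" "l < card J"
  shows "pick J l < n"
  using pick_in_set_le[OF assms(2)] assms(1) by auto

text \<open>\<open>f\<close> lists \<open>J\<close> in some order and \<open>pick J\<close> in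
  increasing order; the permutation between them costs the sign. This leads from selections by
  functions to minors indexed by sets.\<close>

lemma det_select_columns:
  assumes A: "A \<in> carrier_mat k n" and f: "inj_on f {..<k}" "f ` {..<k} = J" and J: "J \<subseteq> {..<n}"
  shows "\<exists>s\<in>{1, -1}. det (mat k k (\<lambda>(i, j). A $$ (i, f j))) = s * det (submatrix A UNIV J)"
proof -
  have card: "card J = k" using f by (metis card_image card_lessThan)
  have "finite J" using J finite_subset by blast
  from bij_betw_pick[OF this] have pick: "bij_betw (pick J) {..<k} J" by (simp add: card)
  define p where "p i = (if i < k then inv_into {..<k} (pick J) (f i) else i)" for i
  have "bij_betw f {..<k} J" using f by (simp add: bij_betw_def)
  then have "bij_betw (inv_into {..<k} (pick J) \<circ> f) {..<k} {..<k}"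
    using bij_betw_inv_into[OF pick] by (rule bij_betw_trans)
  then have "bij_betw p {..<k} {..<k}"
    by (subst bij_betw_cong[of _ _ "inv_into {..<k} (pick J) \<circ> f"]) (auto simp: p_def)
  then have p: "p permutes {0..<k}"
    by (intro bij_imp_permutes) (auto simp: p_def atLeast0LessThan)
  have pick_p: "pick J (p j) = f j" if "j < k" for j
    using that f pick by (auto simp: p_def bij_betw_def intro!: f_inv_into_f)
  have p_lt: "p j < k" if "j < k" for j
    using permutes_in_image[OF p, of j] that by simp
  have sub: "submatrix A UNIV J \<in> carrier_mat k k"
    using submatrix_columns_carrier[OF A J] card by simp
  have "mat k k (\<lambda>(i, j). A $$ (i, f j)) = mat k k (\<lambda>(i, j). submatrix A UNIV J $$ (i, p j))"
    by (intro cong_mat refl) (simp add: submatrix_columns_index[OF A J] card p_lt pick_p)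
  then have "det (mat k k (\<lambda>(i, j). A $$ (i, f j))) = signof p * det (submatrix A UNIV J)"
    using det_permute_columns[OF sub p] by (simp only:)
  then show ?thesis by (rule bexI) (rule signof_pm_one)
qed

text \<open>Append a column \<open>j\<close> to a selection that is nonsingular on the first
  \<open>k\<close> rows and expand along it. The cofactors do not depend on \<open>j\<close>, so if
  all these determinants vanished they would form a relation among the rows of \<open>A\<close>,
  although the last cofactor is the nonzero minor at hand. Selecting by a function means that
  repetitions need not be excluded during the induction.\<close>

lemma ex_nonzero_column_selection:
  fixes A :: "'a::idom mat"
  assumes "A \<in> carrier_mat k n"
    and "\<And>u. u \<in> carrier_vec k \<Longrightarrow> transpose_mat A *\<^sub>v u = 0\<^sub>v n \<Longrightarrow> u = 0\<^sub>v k"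
  shows "\<exists>f. (\<forall>i<k. f i < n) \<and> det (mat k k (\<lambda>(i, j). A $$ (i, f j))) \<noteq> 0"
  using assms
proof (induction k arbitrary: A)
  case 0
  then show ?case by simp
next
  case (Suc k)
  note A = Suc.prems(1)
  define A' where "A' = mat k n (\<lambda>(i, j). A $$ (i, j))"
  have A': "A' \<in> carrier_mat k n" by (simp add: A'_def)
  have "u = 0\<^sub>v k" if u: "u \<in> carrier_vec k" and 0: "transpose_mat A' *\<^sub>v u = 0\<^sub>v n" for u
  proof -
    define w where "w = vec (Suc k) (\<lambda>i. if i < k then u $ i else 0)"
    have "transpose_mat A *\<^sub>v w = transpose_mat A' *\<^sub>v u"
      using A A' u by (intro eq_vecI) (auto simp: w_def A'_def scalar_prod_def)
    then have "w = 0\<^sub>v (Suc k)" using 0 by (intro Suc.prems(2)) (auto simp: w_def)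
    then have "w $ i = 0" if "i < k" for i using that by simp
    then show "u = 0\<^sub>v k" using u by (intro eq_vecI) (auto simp: w_def)
  qed
  from Suc.IH[OF A' this] obtain f where f: "\<And>i. i < k \<Longrightarrow> f i < n"
    and nz: "det (mat k k (\<lambda>(i, j). A' $$ (i, f j))) \<noteq> 0" by auto
  define B where "B j = mat (Suc k) (Suc k) (\<lambda>(i, l). A $$ (i, if l < k then f l else j))" for j
  have B: "B j \<in> carrier_mat (Suc k) (Suc k)" for j by (simp add: B_def)
  define c where "c = vec (Suc k) (\<lambda>i. cofactor (B 0) i k)"
  \<comment> \<open>Deleting column \<open>k\<close> removes the only column that depends on
    \<open>j\<close>.\<close>
  have cof: "cofactor (B j) i k = c $ i" if "i < Suc k" for i j
  proof -
    have "mat_delete (B j) i k = mat_delete (B 0) i k"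
      using that by (intro eq_matI) (auto simp: B_def mat_delete_def)
    then show ?thesis using that by (simp add: c_def cofactor_def)
  qed
  have det_B: "det (B j) = (\<Sum>i<Suc k. A $$ (i, j) * c $ i)" for j
    unfolding laplace_expansion_column[OF B lessI] using cof
    by (intro sum.cong) (auto simp: B_def)
  have "mat_delete (B 0) k k = mat k k (\<lambda>(i, j). A' $$ (i, f j))"
    using f by (intro eq_matI) (auto simp: B_def A'_def mat_delete_def)
  then have "c $ k \<noteq> 0" using nz by (simp add: c_def cofactor_def)
  then have "c \<noteq> 0\<^sub>v (Suc k)" by auto
  then have "transpose_mat A *\<^sub>v c \<noteq> 0\<^sub>v n"
    using Suc.prems(2)[of c] by (auto simp: c_def)
  then obtain j where j: "j < n" "(transpose_mat A *\<^sub>v c) $ j \<noteq> 0"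
    using A by (metis eq_vecI index_zero_vec dim_mult_mat_vec index_transpose_mat(2) carrier_matD(2))
  have "(transpose_mat A *\<^sub>v c) $ j = (\<Sum>i<Suc k. A $$ (i, j) * c $ i)"
    using A j by (auto simp: scalar_prod_def c_def atLeast0LessThan intro!: sum.cong)
  then have "det (B j) \<noteq> 0" using j det_B by simp
  moreover have "B j = mat (Suc k) (Suc k) (\<lambda>(i, l). A $$ (i, (f(k := j)) l))"
    by (intro eq_matI) (auto simp: B_def less_Suc_eq)
  ultimately have "det (mat (Suc k) (Suc k) (\<lambda>(i, l). A $$ (i, (f(k := j)) l))) \<noteq> 0" by simp
  moreover have "\<forall>i<Suc k. (f(k := j)) i < n" using f j by (auto simp: less_Suc_eq)
  ultimately show ?case by blast
qed

lemma ex_nonzero_maximal_minor: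
  fixes A :: "'a::idom mat"
  assumes A: "A \<in> carrier_mat k n"
    and indep: "\<And>u. u \<in> carrier_vec k \<Longrightarrow> transpose_mat A *\<^sub>v u = 0\<^sub>v n \<Longrightarrow> u = 0\<^sub>v k"
  obtains J where "J \<subseteq> {..<n}" "card J = k" "det (submatrix A UNIV J) \<noteq> 0"
proof -
  from ex_nonzero_column_selection[OF A indep] obtain f
    where f: "\<And>i. i < k \<Longrightarrow> f i < n" and nz: "det (mat k k (\<lambda>(i, j). A $$ (i, f j))) \<noteq> 0"
    by blast
  have inj: "inj_on f {..<k}"
  proof (rule inj_onI, rule ccontr)
    fix i j assume ij: "i \<in> {..<k}" "j \<in> {..<k}" "f i = f j" "i \<noteq> j"
    then have "col (mat k k (\<lambda>(i, j). A $$ (i, f j))) i = col (mat k k (\<lambda>(i, j). A $$ (i, f j))) j"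
      by (intro eq_vecI) auto
    then have "det (mat k k (\<lambda>(i, j). A $$ (i, f j))) = 0"
      using ij by (intro det_identical_columns[of _ k i j]) auto
    then show False using nz by contradiction
  qed
  have sub: "f ` {..<k} \<subseteq> {..<n}" using f by auto
  show thesis
  proof (rule that[OF sub])
    show "card (f ` {..<k}) = k" using inj by (simp add: card_image)
    show "det (submatrix A UNIV (f ` {..<k})) \<noteq> 0"
      using det_select_columns[OF A inj refl sub] nz by auto
  qed
qed

section \<open>Splitting matrices along a set of columns\<close>

lemma map_mat_submatrix_columns:
  assumes "A \<in> carrier_mat k n" "J \<subseteq> {..<n}"
  shows "map_mat h (submatrix A UNIV J) = submatrix (map_mat h A) UNIV J"
  using assms submatrix_columns_carrier[OF assms] submatrix_columns_carrier[of "map_mat h A" k n J]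
  by (intro eq_matI) (auto simp: submatrix_columns_index[of _ k n] pick_lt)

lemma submatrix_columns_mult:
  assumes A: "A \<in> carrier_mat k k" and B: "B \<in> carrier_mat k n" and J: "J \<subseteq> {..<n}"
  shows "submatrix (A * B) UNIV J = A * submatrix B UNIV J"
proof (rule eq_matI)
  note sB = submatrix_columns_carrier[OF B J]
  have AB: "A * B \<in> carrier_mat k n" using A B by simp
  note sAB = submatrix_columns_carrier[OF AB J]
  fix i l assume "i < dim_row (A * submatrix B UNIV J)" "l < dim_col (A * submatrix B UNIV J)"
  then have il: "i < k" "l < card J" using A sB by auto
  have "(A * B) $$ (i, pick J l) = (\<Sum>a = 0..<k. A $$ (i, a) * B $$ (a, pick J l))"
    using A B il pick_lt[OF J] by (simp add: scalar_prod_def)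
  also have "\<dots> = (A * submatrix B UNIV J) $$ (i, l)"
    using A B il sB by (simp add: scalar_prod_def submatrix_columns_index[OF B J])
  finally show "submatrix (A * B) UNIV J $$ (i, l) = (A * submatrix B UNIV J) $$ (i, l)"
    using submatrix_columns_index[OF AB J il] by simp
qed (use submatrix_columns_carrier[of "A * B" k n J] submatrix_columns_carrier[OF B J] A B J in auto)

lemma submatrix_columns_add:
  assumes A: "A \<in> carrier_mat k n" and B: "B \<in> carrier_mat k n" and J: "J \<subseteq> {..<n}"
  shows "submatrix (A + B) UNIV J = submatrix A UNIV J + submatrix B UNIV J"
proof -
  have AB: "A + B \<in> carrier_mat k n" using A B by simp
  show ?thesis
    using A B submatrix_columns_carrier[OF A J] submatrix_columns_carrier[OF B J]
      submatrix_columns_carrier[OF AB J]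
    by (intro eq_matI) (auto simp: submatrix_columns_index[OF A J] submatrix_columns_index[OF B J]
        submatrix_columns_index[OF AB J] pick_lt[OF J])
qed

lemma sum_split_pick:
  assumes J: "J \<subseteq> {..<n}"
  shows "(\<Sum>j = 0..<n. g j) =
    (\<Sum>l = 0..<card J. g (pick J l)) + (\<Sum>l = 0..<card ({..<n} - J). g (pick ({..<n} - J) l))"
proof -
  have *: "(\<Sum>l<card S. g (pick S l)) = sum g S" if "finite S" for S
    using that by (intro sum.reindex_bij_betw bij_betw_pick)
  have "finite J" using J finite_subset by blast
  then show ?thesis
    using sum.subset_diff[OF J, of g] by (simp add: * atLeast0LessThan add.commute)
qed

lemma mult_mat_vec_split:
  assumes A: "A \<in> carrier_mat k n" and v: "v \<in> carrier_vec n" and J: "J \<subseteq> {..<n}"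
  shows "A *\<^sub>v v = submatrix A UNIV J *\<^sub>v vec (card J) (\<lambda>l. v $ pick J l) +
    submatrix A UNIV ({..<n} - J) *\<^sub>v vec (card ({..<n} - J)) (\<lambda>l. v $ pick ({..<n} - J) l)"
proof -
  have c: "{..<n} - J \<subseteq> {..<n}" by blast
  note carr = submatrix_columns_carrier[OF A J] submatrix_columns_carrier[OF A c]
  show ?thesis
  proof (rule eq_vecI)
    fix i assume "i < dim_vec (submatrix A UNIV J *\<^sub>v vec (card J) (\<lambda>l. v $ pick J l) +
      submatrix A UNIV ({..<n} - J) *\<^sub>v vec (card ({..<n} - J)) (\<lambda>l. v $ pick ({..<n} - J) l))"
    then have i: "i < k" using carr by simp
    have "(A *\<^sub>v v) $ i = (\<Sum>j = 0..<n. A $$ (i, j) * v $ j)"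
      using A v i by (simp add: scalar_prod_def)
    then show "(A *\<^sub>v v) $ i = (submatrix A UNIV J *\<^sub>v vec (card J) (\<lambda>l. v $ pick J l) +
      submatrix A UNIV ({..<n} - J) *\<^sub>v vec (card ({..<n} - J)) (\<lambda>l. v $ pick ({..<n} - J) l)) $ i"
      unfolding sum_split_pick[OF J] using i carr
      by (simp add: scalar_prod_def submatrix_columns_index[OF A J i] submatrix_columns_index[OF A c i])
  qed (use A carr in auto)
qed

lemma mult_transpose_split:
  assumes A: "A \<in> carrier_mat k n" and B: "B \<in> carrier_mat m n" and J: "J \<subseteq> {..<n}"
  shows "A * transpose_mat B = submatrix A UNIV J * transpose_mat (submatrix B UNIV J) +
    submatrix A UNIV ({..<n} - J) * transpose_mat (submatrix B UNIV ({..<n} - J))"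
proof -
  have c: "{..<n} - J \<subseteq> {..<n}" by blast
  note carr = submatrix_columns_carrier[OF A J] submatrix_columns_carrier[OF A c]
    submatrix_columns_carrier[OF B J] submatrix_columns_carrier[OF B c]
  show ?thesis
  proof (rule eq_matI)
    fix i j assume "i < dim_row (submatrix A UNIV J * transpose_mat (submatrix B UNIV J) +
        submatrix A UNIV ({..<n} - J) * transpose_mat (submatrix B UNIV ({..<n} - J)))"
      "j < dim_col (submatrix A UNIV J * transpose_mat (submatrix B UNIV J) +
        submatrix A UNIV ({..<n} - J) * transpose_mat (submatrix B UNIV ({..<n} - J)))"
    then have ij: "i < k" "j < m" using carr by simp_all
    have "(A * transpose_mat B) $$ (i, j) = (\<Sum>l = 0..<n. A $$ (i, l) * B $$ (j, l))"
      using A B ij by (simp add: scalar_prod_def)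
    then show "(A * transpose_mat B) $$ (i, j) =
      (submatrix A UNIV J * transpose_mat (submatrix B UNIV J) +
        submatrix A UNIV ({..<n} - J) * transpose_mat (submatrix B UNIV ({..<n} - J))) $$ (i, j)"
      unfolding sum_split_pick[OF J] using ij carr
      by (simp add: scalar_prod_def submatrix_columns_index[OF A J] submatrix_columns_index[OF A c]
        submatrix_columns_index[OF B J] submatrix_columns_index[OF B c])
  qed (use A B carr in auto)
qed

lemma ex_mat_with_columns:
  assumes J: "J \<subseteq> {..<n}" and X: "X \<in> carrier_mat k (card J)"
    and Y: "Y \<in> carrier_mat k (card ({..<n} - J))"
  obtains G where "G \<in> carrier_mat k n" "submatrix G UNIV J = X" "submatrix G UNIV ({..<n} - J) = Y"
proof -
  let ?c = "{..<n} - J"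
  have c: "?c \<subseteq> {..<n}" by blast
  \<comment> \<open>The cardinalities give the position of \<open>j\<close> within \<open>J\<close>
    or within its complement, inverse to \<open>pick\<close>.\<close>
  define G where "G = mat k n (\<lambda>(i, j). if j \<in> J then X $$ (i, card {a \<in> J. a < j})
    else Y $$ (i, card {a \<in> ?c. a < j}))"
  have G: "G \<in> carrier_mat k n" by (simp add: G_def)
  have "submatrix G UNIV J $$ (i, l) = X $$ (i, l)" if "i < k" "l < card J" for i l
    using that pick_in_set_le[of l J] card_pick_le[of l J] pick_lt[OF J that(2)]
    by (subst submatrix_columns_index[OF G J]) (auto simp: G_def)
  then have 1: "submatrix G UNIV J = X"
    using X submatrix_columns_carrier[OF G J] by (intro eq_matI) auto
  have "submatrix G UNIV ?c $$ (i, l) = Y $$ (i, l)" if "i < k" "l < card ?c" for i l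
    using that pick_in_set_le[of l ?c] card_pick_le[of l ?c] pick_lt[OF c that(2)]
    by (subst submatrix_columns_index[OF G c]) (auto simp: G_def)
  then have 2: "submatrix G UNIV ?c = Y"
    using Y submatrix_columns_carrier[OF G c] by (intro eq_matI) auto
  show thesis using that G 1 2 by blast
qed

text \<open>With unit vectors as rows, extracting columns becomes multiplication by a transpose, and
  minors can be reached through determinants of products.\<close>

definition selection_mat :: "nat \<Rightarrow> nat set \<Rightarrow> 'a::comm_ring_1 mat" where
  "selection_mat n J = mat (card J) n (\<lambda>(l, j). if j = pick J l then 1 else 0)"

lemma selection_mat_carrier: "selection_mat n J \<in> carrier_mat (card J) n"
  by (simp add: selection_mat_def)

lemma selection_mat_index:
  "l < card J \<Longrightarrow> j < n \<Longrightarrow> selection_mat n J $$ (l, j) = (if j = pick J l then 1 else 0)"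
  by (simp add: selection_mat_def)

lemma mult_transpose_selection_mat:
  assumes A: "A \<in> carrier_mat k n" and J: "J \<subseteq> {..<n}"
  shows "A * transpose_mat (selection_mat n J) = submatrix A UNIV J"
proof (rule eq_matI)
  note s = submatrix_columns_carrier[OF A J]
  fix i l assume "i < dim_row (submatrix A UNIV J)" "l < dim_col (submatrix A UNIV J)"
  then have il: "i < k" "l < card J" using s by auto
  then show "(A * transpose_mat (selection_mat n J)) $$ (i, l) = submatrix A UNIV J $$ (i, l)"
    using A pick_lt[OF J]
    by (simp add: selection_mat_def scalar_prod_def submatrix_columns_index[OF A J] mult_delta_right)
qed (use A submatrix_columns_carrier[OF A J] in \<open>auto simp: selection_mat_def\<close>)

lemma selection_mat_orthonormal:
  assumes J: "J \<subseteq> {..<n}"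
  shows "selection_mat n J * transpose_mat (selection_mat n J) = 1\<^sub>m (card J)"
proof -
  have fin: "finite J" using J finite_subset by blast
  have eq: "pick J i = pick J j \<longleftrightarrow> i = j" if "i < card J" "j < card J" for i j
    using bij_betw_pick[OF fin] that by (auto simp: bij_betw_def inj_on_def)
  show ?thesis
    unfolding mult_transpose_selection_mat[OF selection_mat_carrier J]
    using submatrix_columns_carrier[OF selection_mat_carrier[of n J] J]
    by (intro eq_matI)
      (auto simp: submatrix_columns_index[OF selection_mat_carrier J] eq selection_mat_index pick_lt[OF J])
qed

lemma selection_mat_orthogonal:
  assumes I: "I \<subseteq> {..<n}" and J: "J \<subseteq> {..<n}" and "I \<inter> J = {}"
  shows "selection_mat n I * transpose_mat (selection_mat n J) = 0\<^sub>m (card I) (card J)"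
proof -
  have ne: "pick J j \<noteq> pick I i" if "i < card I" "j < card J" for i j
    using assms that pick_in_set_le[of i I] pick_in_set_le[of j J] by auto
  show ?thesis
    unfolding mult_transpose_selection_mat[OF selection_mat_carrier J]
    using submatrix_columns_carrier[OF selection_mat_carrier[of n I] J]
    by (intro eq_matI)
      (auto simp: submatrix_columns_index[OF selection_mat_carrier J] ne selection_mat_index pick_lt[OF J])
qed

lemma append_rows_mult_transpose:
  fixes A :: "'a::comm_ring_1 mat"
  assumes "A \<in> carrier_mat k n" "B \<in> carrier_mat m n" "C \<in> carrier_mat k' n" "D \<in> carrier_mat m' n"
  shows "(A @\<^sub>r B) * transpose_mat (C @\<^sub>r D) = four_block_mat
    (A * transpose_mat C) (A * transpose_mat D) (B * transpose_mat C) (B * transpose_mat D)"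
proof -
  have T: "transpose_mat (C @\<^sub>r D) =
      four_block_mat (transpose_mat C) (transpose_mat D) (0\<^sub>m 0 k') (0\<^sub>m 0 m')"
    using assms unfolding append_rows_def
    by (subst transpose_four_block_mat[of _ k' n _ 0 _ m']) auto
  show ?thesis
    unfolding T using assms unfolding append_rows_def
    by (subst mult_four_block_mat[of _ k n _ 0 _ m _ _ k' _ m']) auto
qed

text \<open>For orthogonal \<open>G\<close> and \<open>H\<close>, the product of \<open>G\<close> stacked on the unit rows of the complement of
  \<open>J\<close> with the transpose of the unit rows of \<open>I\<close> stacked on \<open>H\<close> is block triangular.\<close>

lemma complementary_minors:
  fixes G H :: "'a::idom mat"
  assumes G: "G \<in> carrier_mat k n" and H: "H \<in> carrier_mat m n" and n: "k + m = n"
    and GH: "G * transpose_mat H = 0\<^sub>m k m"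
    and I: "I \<subseteq> {..<n}" "card I = k" and J: "J \<subseteq> {..<n}" "card J = k"
  shows "\<exists>s\<in>{1, -1}. det (submatrix G UNIV J) * det (submatrix H UNIV ({..<n} - I)) =
    s * (det (submatrix G UNIV I) * det (submatrix H UNIV ({..<n} - J)))"
proof -
  let ?S = "selection_mat n :: nat set \<Rightarrow> 'a mat"
  have complement: "{..<n} - K \<subseteq> {..<n}" "card ({..<n} - K) = m" "finite K"
    if "K \<subseteq> {..<n}" "card K = k" for K
    using that n finite_subset[OF that(1)] by (auto simp: card_Diff_subset)
  have S: "?S K \<in> carrier_mat k n" "?S ({..<n} - K) \<in> carrier_mat m n"
    if "K \<subseteq> {..<n}" "card K = k" for K
    using selection_mat_carrier[of n K] selection_mat_carrier[of n "{..<n} - K"] complement[OF that] that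
    by simp_all
  have ortho: "?S K * transpose_mat (?S K) = 1\<^sub>m k"
    "?S ({..<n} - K) * transpose_mat (?S ({..<n} - K)) = 1\<^sub>m m"
    "?S K * transpose_mat (?S ({..<n} - K)) = 0\<^sub>m k m"
    "?S ({..<n} - K) * transpose_mat (?S K) = 0\<^sub>m m k"
    if K: "K \<subseteq> {..<n}" "card K = k" for K
    using selection_mat_orthonormal[of K n] selection_mat_orthonormal[of "{..<n} - K" n]
      selection_mat_orthogonal[of K n "{..<n} - K"] selection_mat_orthogonal[of "{..<n} - K" n K]
      complement[OF K] K
    by (auto simp: Diff_triv)
  \<comment> \<open>The determinant of a permutation matrix. Only its square is computed below,
    which fixes it up to sign without counting inversions.\<close>
  define q where "q K = det (?S K @\<^sub>r ?S ({..<n} - K))" for K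
  have stack: "A @\<^sub>r B \<in> carrier_mat n n" if "A \<in> carrier_mat k n" "B \<in> carrier_mat m n" for A B :: "'a mat"
    using that n unfolding append_rows_def by auto
  have det_stack: "det (A @\<^sub>r B) * det (C @\<^sub>r D) = det (four_block_mat
    (A * transpose_mat C) (A * transpose_mat D) (B * transpose_mat C) (B * transpose_mat D))"
    if c: "A \<in> carrier_mat k n" "B \<in> carrier_mat m n" "C \<in> carrier_mat k n" "D \<in> carrier_mat m n"
    for A B C D :: "'a mat"
    using stack[OF c(1,2)] stack[OF c(3,4)]
    by (simp add: det_mult[of _ n] det_transpose flip: append_rows_mult_transpose[OF c])
  have q2: "q K * q K = 1" if K: "K \<subseteq> {..<n}" "card K = k" for K
    unfolding q_def det_stack[OF S[OF K] S[OF K]] ortho[OF K] by simp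
  then have q1: "q K \<in> {1, -1}" if "K \<subseteq> {..<n}" "card K = k" for K
    using that square_eq_1_iff by (auto simp: power2_eq_square)
  note subG = submatrix_columns_carrier[OF G] and subH = submatrix_columns_carrier[OF H]
  \<comment> \<open>Against the unit rows of \<open>J\<close> and of its complement the lower blocks
    become zero and the identity, so only the block of \<open>G\<close> on \<open>J\<close>
    counts.\<close>
  have J_minor: "det (G @\<^sub>r ?S ({..<n} - J)) * q J = det (submatrix G UNIV J)"
    unfolding q_def det_stack[OF G S(2)[OF J] S[OF J]] ortho[OF J]
      mult_transpose_selection_mat[OF G J(1)] mult_transpose_selection_mat[OF G complement(1)[OF J]]
    using subG[OF J(1)] subG[OF complement(1)[OF J]] complement[OF J] J(2)
    by (subst det_four_block_mat_lower_left_zero[of _ k _ m]) simp_all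
  have I_minor: "det (?S I @\<^sub>r H) * q I = det (submatrix H UNIV ({..<n} - I))"
    unfolding q_def det_stack[OF S(1)[OF I] H S[OF I]] ortho[OF I]
      mult_transpose_selection_mat[OF H I(1)] mult_transpose_selection_mat[OF H complement(1)[OF I]]
    using subH[OF I(1)] subH[OF complement(1)[OF I]] complement[OF I] I(2)
    by (subst det_four_block_mat_upper_right_zero[of _ k _ m]) simp_all
  \<comment> \<open>Orthogonality enters here: the upper right block is
    \<open>G * transpose_mat H\<close>, which vanishes.\<close>
  have product: "det (G @\<^sub>r ?S ({..<n} - J)) * det (?S I @\<^sub>r H) =
      det (submatrix G UNIV I) * det (submatrix H UNIV ({..<n} - J))"
  proof -
    have "?S ({..<n} - J) * transpose_mat H = transpose_mat (H * transpose_mat (?S ({..<n} - J)))"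
      using H S[OF J] by (simp add: transpose_mult[of _ m n _ m])
    also have "\<dots> = transpose_mat (submatrix H UNIV ({..<n} - J))"
      by (simp add: mult_transpose_selection_mat[OF H complement(1)[OF J]])
    finally have SH: "?S ({..<n} - J) * transpose_mat H = \<dots>" .
    show ?thesis
      unfolding det_stack[OF G S(2)[OF J] S(1)[OF I] H] GH SH mult_transpose_selection_mat[OF G I(1)]
      using subG[OF I(1)] subH[OF complement(1)[OF J]] complement[OF J] I(2) S[OF I] S[OF J]
      by (subst det_four_block_mat_upper_right_zero[of _ k _ m]) (simp_all add: det_transpose)
  qed
  have "det (submatrix G UNIV J) * det (submatrix H UNIV ({..<n} - I)) =
      (q J * q I) * (det (G @\<^sub>r ?S ({..<n} - J)) * det (?S I @\<^sub>r H))"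
    unfolding J_minor[symmetric] I_minor[symmetric] by (simp only: ac_simps)
  then have "det (submatrix G UNIV J) * det (submatrix H UNIV ({..<n} - I)) =
      (q J * q I) * (det (submatrix G UNIV I) * det (submatrix H UNIV ({..<n} - J)))"
    by (simp only: product)
  moreover have "q J * q I \<in> {1, -1}" using q1[OF I] q1[OF J] by auto
  ultimately show ?thesis by (rule bexI)
qed

section \<open>Orthogonal encoders\<close>

context euclidean_quotient_hom
begin

text \<open>It serves three ends: the dual has an encoder at all, a code can be presented as a dual,
  and the residual degree of a minimal dual encoder is bounded.\<close>

lemma ex_orthogonal_with_dvd_minor:
  assumes nil: "\<pi> ^ r = 0" and G: "G \<in> carrier_mat k n" and J: "J \<subseteq> {..<n}" "card J = k"
  obtains H where "H \<in> carrier_mat (n - k) n" "G * transpose_mat H = 0\<^sub>m k (n - k)"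
    "\<rho> (det (submatrix H UNIV ({..<n} - J))) dvd \<rho> (det (submatrix G UNIV J))"
proof -
  let ?m = "n - k"
  have finJ: "finite J" using J finite_subset by blast
  have c: "{..<n} - J \<subseteq> {..<n}" "card ({..<n} - J) = ?m"
    using J finJ by (auto simp: card_Diff_subset)
  have X: "submatrix G UNIV J \<in> carrier_mat k k" and Y: "submatrix G UNIV ({..<n} - J) \<in> carrier_mat k ?m"
    using submatrix_columns_carrier[OF G J(1)] submatrix_columns_carrier[OF G c(1)] J c by simp_all
  obtain Z A where Z: "Z \<in> carrier_mat ?m ?m" and A: "A \<in> carrier_mat k ?m"
    and eq: "submatrix G UNIV ({..<n} - J) * Z = submatrix G UNIV J * A"
    and dvd: "\<rho> (det Z) dvd \<rho> (det (submatrix G UNIV J))"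
    using ex_right_fraction[OF nil X Y] .
  obtain H where H: "H \<in> carrier_mat ?m n" "submatrix H UNIV J = transpose_mat (- A)"
    "submatrix H UNIV ({..<n} - J) = transpose_mat Z"
    using ex_mat_with_columns[OF J(1), of "transpose_mat (- A)" ?m "transpose_mat Z"] A Z J c by auto
  have "G * transpose_mat H = submatrix G UNIV J * - A + submatrix G UNIV J * A"
    unfolding mult_transpose_split[OF G H(1) J(1)] H(2,3) by (simp add: eq)
  also have "\<dots> = 0\<^sub>m k ?m"
    using X A by (simp add: uminus_mult_right_mat[of _ _ ] uminus_l_inv_mat[of _ k ?m])
  finally show thesis using that H Z dvd by (simp add: det_transpose)
qed

text \<open>Row combinations of \<open>H1\<close> and \<open>H2\<close> stay orthogonal to
  \<open>G\<close>. The combination is chosen after reduction: the two transposed blocks have a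
  greatest common left divisor \<open>N\<close>, and its Bezout coefficients, lifted, produce an
  \<open>H\<close> whose \<open>K\<close>-minor reduces to \<open>det N\<close>.\<close>

lemma ex_orthogonal_with_common_divisor_minor:
  assumes G: "G \<in> carrier_mat k n" and K: "K \<subseteq> {..<n}" "card K = m"
    and H1: "H1 \<in> carrier_mat m n" "G * transpose_mat H1 = 0\<^sub>m k m"
    and H2: "H2 \<in> carrier_mat m n" "G * transpose_mat H2 = 0\<^sub>m k m"
  obtains H where "H \<in> carrier_mat m n" "G * transpose_mat H = 0\<^sub>m k m"
    "\<rho> (det (submatrix H UNIV K)) dvd \<rho> (det (submatrix H1 UNIV K))"
    "\<rho> (det (submatrix H UNIV K)) dvd \<rho> (det (submatrix H2 UNIV K))"
proof -
  let ?Z1 = "submatrix H1 UNIV K" and ?Z2 = "submatrix H2 UNIV K"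
  have Z: "?Z1 \<in> carrier_mat m m" "?Z2 \<in> carrier_mat m m"
    using submatrix_columns_carrier[OF H1(1) K(1)] submatrix_columns_carrier[OF H2(1) K(1)] K by simp_all
  let ?X = "transpose_mat (map_mat \<rho> ?Z1)" and ?Y = "transpose_mat (map_mat \<rho> ?Z2)"
  have XY: "?X \<in> carrier_mat m m" "?Y \<in> carrier_mat m m" using Z by auto
  obtain u1 u3 v1 v2 N where u: "u1 \<in> carrier_mat m m" "u3 \<in> carrier_mat m m"
    "v1 \<in> carrier_mat m m" "v2 \<in> carrier_mat m m" "N \<in> carrier_mat m m"
    and N: "N = ?X * u1 + ?Y * u3" "?X = N * v1" "?Y = N * v2"
    using ex_block_column_reduction[OF XY] by metis
  obtain U1 where U1: "U1 \<in> carrier_mat m m" "map_mat \<rho> U1 = u1" using u(1) by (rule lift_mat)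
  obtain U3 where U3: "U3 \<in> carrier_mat m m" "map_mat \<rho> U3 = u3" using u(2) by (rule lift_mat)
  define H where "H = transpose_mat U1 * H1 + transpose_mat U3 * H2"
  have H: "H \<in> carrier_mat m n" using U1 U3 H1 H2 by (simp add: H_def)
  have "transpose_mat H = transpose_mat H1 * U1 + transpose_mat H2 * U3"
    using U1(1) U3(1) H1(1) H2(1)
    by (simp add: H_def transpose_add[of _ m n] transpose_mult[of _ m m _ n])
  then have "G * transpose_mat H =
      G * transpose_mat H1 * U1 + G * transpose_mat H2 * U3"
    using G U1(1) U3(1) H1(1) H2(1)
    by (simp add: mult_add_distrib_mat[of _ k n _ m] assoc_mult_mat[of _ k n _ m _ m])
  also have "\<dots> = 0\<^sub>m k m" unfolding H1(2) H2(2) using U1(1) U3(1) by simp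
  finally have GH: "G * transpose_mat H = 0\<^sub>m k m" .
  have "submatrix H UNIV K = transpose_mat U1 * ?Z1 + transpose_mat U3 * ?Z2"
  proof -
    have *: "transpose_mat U1 * H1 \<in> carrier_mat m n" "transpose_mat U3 * H2 \<in> carrier_mat m n"
      using U1 U3 H1 H2 by simp_all
    show ?thesis
      unfolding H_def submatrix_columns_add[OF * K(1)]
      using submatrix_columns_mult[OF _ H1(1) K(1), of "transpose_mat U1"]
        submatrix_columns_mult[OF _ H2(1) K(1), of "transpose_mat U3"] U1(1) U3(1) by simp
  qed
  then have "transpose_mat (submatrix H UNIV K) = transpose_mat ?Z1 * U1 + transpose_mat ?Z2 * U3"
    using U1(1) U3(1) Z by (simp add: transpose_add[of _ m m] transpose_mult[of _ m m _ m])
  then have "map_mat \<rho> (transpose_mat (submatrix H UNIV K)) = N"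
    unfolding N(1) U1(2)[symmetric] U3(2)[symmetric] using U1(1) U3(1) Z
    by (simp add: map_mat_plus[of _ m m] mat_hom_mult[of _ m m _ m] map_mat_transpose)
  then have detN: "\<rho> (det (submatrix H UNIV K)) = det N"
    using submatrix_columns_carrier[OF H K(1)] K(2) by (metis hom_det det_transpose)
  have "\<rho> (det ?Z1) = det N * det v1" "\<rho> (det ?Z2) = det N * det v2"
    using N(2,3) u Z by (metis hom_det det_transpose det_mult map_carrier_mat)+
  then show thesis using that[OF H GH] detN by simp
qed

end

section \<open>Unit minors, kernels and dual codes\<close>

lemma det_unit_mult_mat_vec_eq_0D:
  fixes A :: "'a::comm_ring_1 mat"
  assumes A: "A \<in> carrier_mat n n" and unit: "det A dvd 1" and v: "v \<in> carrier_vec n"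
    and 0: "A *\<^sub>v v = 0\<^sub>v n"
  shows "v = 0\<^sub>v n"
proof -
  obtain d where d: "1 = det A * d" using unit by (elim dvdE)
  have "det A \<cdot>\<^sub>v v = (adj_mat A * A) *\<^sub>v v"
    unfolding adj_mat(3)[OF A] using v by (intro eq_vecI) auto
  also have "\<dots> = adj_mat A *\<^sub>v (A *\<^sub>v v)"
    using adj_mat(1)[OF A] A v by (rule assoc_mult_mat_vec)
  also have "\<dots> = 0\<^sub>v n" unfolding 0 using adj_mat(1)[OF A] by (intro eq_vecI) auto
  finally have eq: "det A \<cdot>\<^sub>v v = 0\<^sub>v n" .
  have "v $ i = 0" if "i < n" for i
  proof -
    have "det A * v $ i = 0" using arg_cong[OF eq, of "\<lambda>w :: 'a vec. w $ i"] that v by simp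
    then have "d * (det A * v $ i) = 0" by simp
    then show ?thesis using d by (simp add: mult.assoc[symmetric] mult.commute[of d])
  qed
  then show ?thesis using v by (intro eq_vecI) auto
qed

lemma det_unit_ex_mult_mat_vec:
  fixes A :: "'a::comm_ring_1 mat"
  assumes A: "A \<in> carrier_mat n n" and unit: "det A dvd 1" and b: "b \<in> carrier_vec n"
  obtains v where "v \<in> carrier_vec n" "A *\<^sub>v v = b"
proof -
  obtain d where d: "1 = det A * d" using unit by (elim dvdE)
  let ?v = "adj_mat A *\<^sub>v (d \<cdot>\<^sub>v b)"
  have "A *\<^sub>v ?v = (A * adj_mat A) *\<^sub>v (d \<cdot>\<^sub>v b)"
    using adj_mat(1)[OF A] A b by (intro assoc_mult_mat_vec[symmetric]) auto
  also have "\<dots> = b"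
    unfolding adj_mat(2)[OF A] using b d by (intro eq_vecI) (auto simp: mult.assoc[symmetric] mult.commute[of d] simp flip: d)
  finally show thesis using that[of ?v] adj_mat(1)[OF A] b by simp
qed

text \<open>The unit minor of \<open>G\<close> means that a kernel vector is determined by its
  coordinates outside \<open>J\<close>; the unit minor of \<open>H\<close> means that a unique
  combination of rows of \<open>H\<close> takes prescribed values there.\<close>

lemma orthogonal_unit_minors:
  fixes G H :: "'a::comm_ring_1 mat"
  assumes G: "G \<in> carrier_mat k n" and H: "H \<in> carrier_mat m n"
    and GH: "G * transpose_mat H = 0\<^sub>m k m"
    and J: "J \<subseteq> {..<n}" "card J = k" "card ({..<n} - J) = m"
    and unit: "det (submatrix G UNIV J) dvd 1" "det (submatrix H UNIV ({..<n} - J)) dvd 1"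
  shows "{v \<in> carrier_vec n. G *\<^sub>v v = 0\<^sub>v k} = (*\<^sub>v) (transpose_mat H) ` carrier_vec m"
    and "u \<in> carrier_vec m \<Longrightarrow> transpose_mat H *\<^sub>v u = 0\<^sub>v n \<Longrightarrow> u = 0\<^sub>v m"
proof -
  let ?c = "{..<n} - J"
  have c: "?c \<subseteq> {..<n}" by blast
  have sG: "submatrix G UNIV J \<in> carrier_mat k k" "submatrix G UNIV ?c \<in> carrier_mat k m"
    using submatrix_columns_carrier[OF G J(1)] submatrix_columns_carrier[OF G c] J by simp_all
  have sH: "submatrix H UNIV ?c \<in> carrier_mat m m"
    using submatrix_columns_carrier[OF H c] J by simp
  then have tH: "transpose_mat (submatrix H UNIV ?c) \<in> carrier_mat m m"
    "det (transpose_mat (submatrix H UNIV ?c)) dvd 1"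
    using unit by (simp_all add: det_transpose)
  have restrict: "vec m (\<lambda>l. (transpose_mat H *\<^sub>v u) $ pick ?c l) = transpose_mat (submatrix H UNIV ?c) *\<^sub>v u"
    if u: "u \<in> carrier_vec m" for u
  proof (rule eq_vecI)
    fix l assume "l < dim_vec (transpose_mat (submatrix H UNIV ?c) *\<^sub>v u)"
    then have l: "l < m" using sH by simp
    then have "l < card ?c" using J by simp
    with l show "vec m (\<lambda>l. (transpose_mat H *\<^sub>v u) $ pick ?c l) $ l =
        (transpose_mat (submatrix H UNIV ?c) *\<^sub>v u) $ l"
      using u H sH pick_lt[OF c, of l]
      by (auto simp: scalar_prod_def submatrix_columns_index[OF H c] intro!: sum.cong)
  qed (use sH in simp)
  show "u = 0\<^sub>v m" if u: "u \<in> carrier_vec m" and 0: "transpose_mat H *\<^sub>v u = 0\<^sub>v n" for u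
  proof (rule det_unit_mult_mat_vec_eq_0D[OF tH u])
    show "transpose_mat (submatrix H UNIV ?c) *\<^sub>v u = 0\<^sub>v m"
      unfolding restrict[OF u, symmetric] 0 using pick_lt[OF c] J by (intro eq_vecI) auto
  qed
  show "{v \<in> carrier_vec n. G *\<^sub>v v = 0\<^sub>v k} = (*\<^sub>v) (transpose_mat H) ` carrier_vec m"
  proof (intro equalityI subsetI)
    fix v assume "v \<in> (*\<^sub>v) (transpose_mat H) ` carrier_vec m"
    then obtain u where u: "u \<in> carrier_vec m" "v = transpose_mat H *\<^sub>v u" by blast
    have "G *\<^sub>v v = (G * transpose_mat H) *\<^sub>v u"
      using G H u by (simp add: assoc_mult_mat_vec[of _ k n _ m])
    also have "\<dots> = 0\<^sub>v k" unfolding GH using u by (intro eq_vecI) auto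
    finally show "v \<in> {v \<in> carrier_vec n. G *\<^sub>v v = 0\<^sub>v k}" using u H by simp
  next
    fix v assume "v \<in> {v \<in> carrier_vec n. G *\<^sub>v v = 0\<^sub>v k}"
    then have v: "v \<in> carrier_vec n" and Gv: "G *\<^sub>v v = 0\<^sub>v k" by auto
    obtain u where u: "u \<in> carrier_vec m"
      and eq: "transpose_mat (submatrix H UNIV ?c) *\<^sub>v u = vec m (\<lambda>l. v $ pick ?c l)"
      using det_unit_ex_mult_mat_vec[OF tH, of "vec m (\<lambda>l. v $ pick ?c l)"] by auto
    \<comment> \<open>\<open>w\<close> lies in the kernel and vanishes outside \<open>J\<close> by
      the choice of \<open>u\<close>, hence it vanishes on \<open>J\<close> as well.\<close>
    define w where "w = v - transpose_mat H *\<^sub>v u"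
    have w: "w \<in> carrier_vec n" using v u H by (simp add: w_def)
    have GHu: "G *\<^sub>v (transpose_mat H *\<^sub>v u) = 0\<^sub>v k"
      using G H u GH by (intro eq_vecI) (auto simp flip: assoc_mult_mat_vec[of _ k n _ m])
    have Gw: "G *\<^sub>v w = 0\<^sub>v k"
      unfolding w_def using G v u H Gv GHu by (simp add: mult_minus_distrib_mat_vec[of _ k n])
    have "w $ pick ?c l = 0" if "l < m" for l
      using arg_cong[OF trans[OF restrict[OF u] eq], of "\<lambda>x :: 'a vec. x $ l"] that v u H pick_lt[OF c, of l] J
      by (simp add: w_def)
    then have wc: "vec (card ?c) (\<lambda>l. w $ pick ?c l) = 0\<^sub>v m" using J by (intro eq_vecI) auto
    have "submatrix G UNIV J *\<^sub>v vec k (\<lambda>l. w $ pick J l) = 0\<^sub>v k"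
      using mult_mat_vec_split[OF G w J(1)] unfolding Gw wc J(2) using sG
      by (intro eq_vecI) auto
    then have "vec k (\<lambda>l. w $ pick J l) = 0\<^sub>v k"
      using det_unit_mult_mat_vec_eq_0D[OF sG(1) unit(1)] by simp
    then have wJ: "w $ pick J l = 0" if "l < k" for l using that by (metis index_vec index_zero_vec(1))
    have "w $ j = 0" if "j < n" for j
    proof (cases "j \<in> J")
      case True
      have "finite J" using J(1) finite_subset by blast
      from bij_betw_pick[OF this] True obtain l where "l < k" "j = pick J l"
        using J(2) by (auto simp: bij_betw_def)
      then show ?thesis using wJ by simp
    next
      case False
      have "finite ?c" by simp
      from bij_betw_pick[OF this] False that obtain l where "l < m" "j = pick ?c l"
        using J(3) by (auto simp: bij_betw_def)
      then show ?thesis using \<open>\<And>l. l < m \<Longrightarrow> w $ pick ?c l = 0\<close> by simp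
    qed
    then have "v = transpose_mat H *\<^sub>v u"
      using v u H unfolding w_def by (intro eq_vecI) auto
    then show "v \<in> (*\<^sub>v) (transpose_mat H) ` carrier_vec m" using u by blast
  qed
qed

interpretation fls_of_poly_hom: inj_comm_ring_hom "fls_of_poly :: 'a::comm_ring_1 poly \<Rightarrow> 'a fls"
  by unfold_locales
    (simp_all add: fls_of_poly_def fps_of_poly_add fps_of_poly_mult fls_times_fps_to_fls fps_of_poly_eq_iff)

lemma dual_code_row_code:
  assumes G: "G \<in> carrier_mat k n"
  shows "dual_code n (row_code G) = {v \<in> carrier_vec n. map_mat fls_of_poly G *\<^sub>v v = 0\<^sub>v k}"
proof -
  let ?G = "map_mat fls_of_poly G"
  have G': "?G \<in> carrier_mat k n" using G by simp
  have prod: "v \<bullet> encode G u = (?G *\<^sub>v v) \<bullet> u" if "v \<in> carrier_vec n" "u \<in> carrier_vec k" for u v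
  proof -
    have "transpose_mat ?G *\<^sub>v u \<in> carrier_vec n" using G' that by simp
    then have "v \<bullet> encode G u = (transpose_mat ?G *\<^sub>v u) \<bullet> v"
      unfolding encode_def using that(1) by (intro comm_scalar_prod)
    also have "\<dots> = u \<bullet> (?G *\<^sub>v v)" by (rule transpose_vec_mult_scalar[OF G' that])
    also have "\<dots> = (?G *\<^sub>v v) \<bullet> u" using G' that by (intro comm_scalar_prod[of _ k]) auto
    finally show ?thesis .
  qed
  have "?G *\<^sub>v v = 0\<^sub>v k" if v: "v \<in> carrier_vec n" and 0: "\<forall>u\<in>carrier_vec k. v \<bullet> encode G u = 0" for v
  proof (rule eq_vecI)
    fix i assume "i < dim_vec (0\<^sub>v k)"
    then have i: "i < k" by simp
    have "(?G *\<^sub>v v) $ i = (?G *\<^sub>v v) \<bullet> unit_vec k i"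
      using i G' v by (simp add: scalar_prod_right_unit[of _ k])
    also have "\<dots> = 0" using prod[OF v] 0 by simp
    finally show "(?G *\<^sub>v v) $ i = 0\<^sub>v k $ i" using i by simp
  qed (use G in simp)
  moreover have "v \<bullet> encode G u = 0"
    if "v \<in> carrier_vec n" "?G *\<^sub>v v = 0\<^sub>v k" "u \<in> carrier_vec k" for u v
    using prod[OF that(1,3)] that by simp
  ultimately show ?thesis
    unfolding dual_code_def row_code_def using G by auto
qed

text \<open>The test by which encoders are recognised from here on. The minors have to be units
  among Laurent series only; as polynomials they may have positive degree.\<close>

lemma generator_matrix_dual_code:
  fixes G H :: "'a::comm_ring_1 poly mat"
  assumes G: "G \<in> carrier_mat k n" and H: "H \<in> carrier_mat m n"
    and GH: "G * transpose_mat H = 0\<^sub>m k m"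
    and J: "J \<subseteq> {..<n}" "card J = k" "card ({..<n} - J) = m"
    and unit: "fls_of_poly (det (submatrix G UNIV J)) dvd 1"
      "fls_of_poly (det (submatrix H UNIV ({..<n} - J))) dvd 1"
  shows "generator_matrix m n (dual_code n (row_code G)) H"
proof -
  let ?G = "map_mat fls_of_poly G" and ?H = "map_mat fls_of_poly H"
  have c: "{..<n} - J \<subseteq> {..<n}" by blast
  have GH': "?G * transpose_mat ?H = 0\<^sub>m k m"
  proof -
    have "?G * transpose_mat ?H = map_mat fls_of_poly (G * transpose_mat H)"
      using G H by (simp add: fls_of_poly_hom.mat_hom_mult[of _ k n _ m] map_mat_transpose)
    then show ?thesis using GH by (auto intro: eq_matI)
  qed
  have minors: "det (submatrix ?G UNIV J) dvd 1" "det (submatrix ?H UNIV ({..<n} - J)) dvd 1"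
    using unit by (simp_all flip: map_mat_submatrix_columns[OF G J(1)] map_mat_submatrix_columns[OF H c])
  have carr: "?G \<in> carrier_mat k n" "?H \<in> carrier_mat m n" using G H by auto
  note * = orthogonal_unit_minors[OF carr GH' J minors]
  show ?thesis
    using H *(2) unfolding generator_matrix_def full_row_rank_def dual_code_row_code[OF G] *(1)
    by (auto simp: encode_def row_code_def)
qed

section \<open>Units and Weierstrass preparation\<close>

lemma unit_plus_nilpotent:
  fixes u t :: "'a::comm_ring_1"
  assumes "u dvd 1" "t ^ r = 0"
  shows "u + t dvd 1"
proof -
  obtain v where v: "u * v = 1" using assms(1) by (metis dvdE)
  \<comment> \<open>Finite geometric series in \<open>- (t * v)\<close>; for \<open>r = 0\<close>
    the assumption reads \<open>1 = 0\<close>.\<close>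
  have "1 = 1 - (- (t * v)) ^ r"
    using assms(2) by (cases "r = 0") (simp_all add: power_minus[of "t * v"] power_mult_distrib)
  also have "\<dots> = (1 + t * v) * (\<Sum>i<r. (- (t * v)) ^ i)" by (simp add: one_diff_power_eq)
  finally have "1 + t * v dvd 1" by (metis dvdI)
  moreover have "1 + t * v = (u + t) * v" by (simp add: distrib_right v)
  ultimately show ?thesis by (metis dvd_mult_left)
qed

lemma fls_X_dvd_1: "(fls_X :: 'a::comm_ring_1 fls) dvd 1"
proof
  show "1 = fls_X * (fls_X_inv :: 'a fls)"
    by (simp add: fls_X_inv_times_conv_shift fls_X_conv_shift_1)
qed

lemma fps_to_fls_dvd_1:
  fixes f :: "'a::comm_ring_1 fps"
  assumes "fps_nth f 0 dvd 1"
  shows "fps_to_fls f dvd 1"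
proof -
  obtain y where "fps_nth f 0 * y = 1" using assms by (metis dvdE)
  then have "f * fps_right_inverse f y = 1" by (rule fps_right_inverse)
  then have "fps_to_fls f * fps_to_fls (fps_right_inverse f y) = 1"
    by (simp flip: fls_times_fps_to_fls)
  then show ?thesis by (metis dvdI)
qed

lemma const_poly_dvd_iff_coeff:
  fixes c :: "'a::comm_ring_1"
  shows "[:c:] dvd p \<longleftrightarrow> (\<forall>n. c dvd coeff p n)"
proof
  show "\<forall>n. c dvd coeff p n \<Longrightarrow> [:c:] dvd p"
  proof (induction p)
    case (pCons a p)
    then have "c dvd a" "\<forall>n. c dvd coeff p n" by (metis coeff_pCons_0, metis coeff_pCons_Suc)
    with pCons.IH obtain b q where "a = c * b" "p = [:c:] * q" by (meson dvdE)
    then have "pCons a p = [:c:] * pCons b q" by simp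
    then show ?case by (rule dvdI)
  qed simp
qed (auto elim!: dvdE)

text \<open>Elements outside the kernel turn out to be units, so \<open>annihilator\<close> amounts
  to \<open>\<pi> ^ (r - 1)\<close> being nonzero. In this form it carries linear independence down
  to the residue field.\<close>

locale nilpotent_reduction = quotient_hom h \<pi>
  for h :: "'a::comm_ring_1 \<Rightarrow> 'b::field" and \<pi> +
  fixes r :: nat
  assumes nilpotent: "\<pi> ^ r = 0"
    and annihilator: "\<pi> ^ (r - 1) * x = 0 \<Longrightarrow> h x = 0"
begin

text \<open>Polynomials over the field \<open>'b\<close> form a Euclidean ring, so the lifted column
  reductions become available for matrices over \<open>'a poly\<close>.\<close>

sublocale poly: euclidean_quotient_hom "map_poly h" "[:\<pi>:]"
proof -
  interpret base: map_poly_comm_ring_hom h ..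
  show "euclidean_quotient_hom (map_poly h) [:\<pi>:]"
  proof unfold_locales
    show "\<exists>x. map_poly h x = y" for y
    proof (induction y)
      case 0
      show ?case using base.hom_zero by blast
    next
      case (pCons a p)
      then obtain x where "map_poly h x = p" by blast
      moreover obtain b where "h b = a" using surj by blast
      ultimately have "map_poly h (pCons b x) = pCons a p" by (simp add: map_poly_pCons_hom)
      then show ?case by blast
    qed
    show "map_poly h x = 0 \<longleftrightarrow> [:\<pi>:] dvd x" for x
      by (simp add: poly_eq_iff const_poly_dvd_iff_coeff kernel)
  qed
qed

lemma poly_nilpotent: "[:\<pi>:] ^ r = 0"
  by (simp add: poly_const_pow nilpotent)

text \<open>A lift of the inverse of \<open>h x\<close> inverts \<open>x\<close> up to a nilpotent
  error.\<close>

lemma unit_if_hom_nonzero: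
  assumes "h x \<noteq> 0"
  shows "x dvd 1"
proof -
  obtain y where "h y = inverse (h x)" using surj by blast
  then have "h (x * y - 1) = 0" using assms by (simp add: hom_minus hom_mult)
  then obtain t where t: "x * y - 1 = \<pi> * t" by (auto simp: kernel)
  then have "x * y = 1 + \<pi> * t" by (simp add: algebra_simps)
  moreover have "1 + \<pi> * t dvd 1"
    by (rule unit_plus_nilpotent[of _ _ r]) (simp_all add: power_mult_distrib nilpotent)
  ultimately show ?thesis by (metis dvd_mult_left)
qed

text \<open>Split \<open>x\<close> at the first coefficient that survives reduction: the part below
  is nilpotent, and the rest is a power of the variable times a series with unit constant
  term.\<close>

lemma fls_of_poly_unit:
  assumes "map_poly h x \<noteq> 0"
  shows "fls_of_poly x dvd 1"
proof -
  have ex: "\<exists>i. h (coeff x i) \<noteq> 0" using assms by (auto simp: poly_eq_iff)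
  define v where "v = (LEAST i. h (coeff x i) \<noteq> 0)"
  have v: "h (coeff x v) \<noteq> 0" unfolding v_def using ex by (rule LeastI_ex)
  have below: "h (coeff x i) = 0" if "i < v" for i
    using not_less_Least[of i "\<lambda>i. h (coeff x i) \<noteq> 0"] that by (simp add: v_def)
  have "map_poly h (poly_cutoff v x) = 0"
    by (auto simp: poly_eq_iff coeff_poly_cutoff below)
  then obtain g where g: "poly_cutoff v x = [:\<pi>:] * g" using poly.kernel by (metis dvdE)
  have split: "x = monom 1 v * poly_shift v x + [:\<pi>:] * g"
    unfolding g[symmetric]
    by (auto simp: poly_eq_iff coeff_monom_mult coeff_poly_shift coeff_poly_cutoff)
  have "fls_of_poly (monom 1 v) = (fls_X :: 'a fls) ^ v"
    by (simp add: fls_of_poly_def fps_of_poly_monom' fps_to_fls_power)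
  then have "fls_of_poly (monom (1 :: 'a) v) dvd 1"
    using fls_X_dvd_1 by (metis dvd_power_same power_one)
  moreover have "fls_of_poly (poly_shift v x) dvd 1"
    unfolding fls_of_poly_def
    by (rule fps_to_fls_dvd_1) (simp add: coeff_poly_shift unit_if_hom_nonzero v)
  ultimately have "fls_of_poly (monom 1 v * poly_shift v x) dvd 1"
    unfolding fls_of_poly_hom.hom_mult by (metis mult_dvd_mono mult_1)
  moreover have "fls_of_poly ([:\<pi>:] * g) ^ r = 0"
    by (simp add: power_mult_distrib poly_nilpotent del: mult_pCons_left flip: fls_of_poly_hom.hom_power)
  ultimately have "fls_of_poly (monom 1 v * poly_shift v x) + fls_of_poly ([:\<pi>:] * g) dvd 1"
    by (rule unit_plus_nilpotent)
  then show ?thesis by (subst split) (simp only: fls_of_poly_hom.hom_add)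
qed

text \<open>Weierstrass preparation by successive approximation modulo powers of \<open>\<pi>\<close>.\<close>

lemma ex_unit_multiple_monic_mod_power:
  assumes "map_poly h x \<noteq> 0"
  shows "\<exists>a m q. a dvd 1 \<and> lead_coeff m = 1 \<and> degree m = degree (map_poly h x) \<and>
    a * x = m + [:\<pi>:] ^ Suc j * q"
proof (induction j)
  case 0
  let ?d = "degree (map_poly h x)"
  have nz: "h (coeff x ?d) \<noteq> 0" using assms by (metis coeff_map_poly hom_zero leading_coeff_0_iff)
  obtain e where e: "h e = inverse (h (coeff x ?d))" using surj by blast
  have e_unit: "e dvd 1" using unit_if_hom_nonzero[of e] e nz by simp
  \<comment> \<open>After scaling by \<open>e\<close> the coefficient at \<open>?d\<close> is 1
    modulo \<pi>. Setting it to 1 and dropping the coefficients above, which lie in the kernel,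
    changes \<open>smult e x\<close> only by a multiple of \<pi>.\<close>
  define m where "m = poly_cutoff ?d (smult e x) + monom 1 ?d"
  have coeff_m: "coeff m i = (if i < ?d then e * coeff x i else if i = ?d then 1 else 0)" for i
    by (simp add: m_def coeff_poly_cutoff)
  have deg: "degree m = ?d"
    by (rule antisym[OF degree_le le_degree]) (auto simp: coeff_m)
  have above: "h (coeff x i) = 0" if "i > ?d" for i
    using that coeff_eq_0[of "map_poly h x" i] by simp
  have "map_poly h (smult e x - m) = 0"
    by (auto simp: poly_eq_iff hom_minus hom_mult coeff_m e nz above not_less_iff_gr_or_eq)
  then obtain q where q: "smult e x - m = [:\<pi>:] * q" using poly.kernel by (metis dvdE)
  have "[:e:] dvd 1" using e_unit by simp
  moreover have "[:e:] * x = m + [:\<pi>:] ^ Suc 0 * q" using q by (simp add: algebra_simps)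
  moreover have "lead_coeff m = 1" by (simp add: deg coeff_m)
  ultimately show ?case using deg by blast
next
  case (Suc j)
  then obtain a m q where a: "a dvd 1" and m: "lead_coeff m = 1" "degree m = degree (map_poly h x)"
    and eq: "a * x = m + [:\<pi>:] ^ Suc j * q" by blast
  \<comment> \<open>As \<open>m\<close> is monic, pseudo-division is division with remainder. The
    remainder goes into the new monic factor without raising its degree, the quotient into the unit
    \<open>1 - P * s\<close>.\<close>
  obtain s b where sb: "pseudo_divmod q m = (s, b)" by fastforce
  have "m \<noteq> 0" using m(1) by auto
  from pseudo_divmod[OF this sb] m(1) have q: "q = m * s + b" and b: "b = 0 \<or> degree b < degree m"
    by auto
  define P where "P = [:\<pi>:] ^ Suc j"
  define m' where "m' = m + P * b"
  have P: "P = [:\<pi> ^ Suc j:]" by (simp add: P_def poly_const_pow)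
  have low: "P * b = 0 \<or> degree (P * b) < degree m"
    using b degree_smult_le[of "\<pi> ^ Suc j" b] by (auto simp: P)
  then have m': "degree m' = degree m" "lead_coeff m' = 1"
    using m(1) unfolding m'_def by (auto simp: degree_add_eq_left coeff_eq_0)
  have "P ^ r = ([:\<pi>:] ^ r) ^ Suc j"
    unfolding P_def by (simp only: power_mult[symmetric] mult.commute)
  then have "(- (P * s)) ^ r = 0"
    by (simp add: poly_nilpotent power_minus[of "P * s"] power_mult_distrib)
  from unit_plus_nilpotent[OF dvd_refl this] have "(1 - P * s) dvd 1" by simp
  then have unit: "(1 - P * s) * a dvd 1" using a by (metis mult_dvd_mono mult_1)
  have "(1 - P * s) * a * x = (1 - P * s) * (m + P * q)"
    by (simp only: mult.assoc eq P_def)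
  \<comment> \<open>The error has become quadratic in \<open>P\<close>; the induction keeps just one
    further power of \<pi> of it.\<close>
  also have "\<dots> = m' - P * P * (s * q)"
    unfolding m'_def q by (simp add: algebra_simps)
  also have "\<dots> = m' + [:\<pi>:] ^ Suc (Suc j) * (- ([:\<pi>:] ^ j * (s * q)))"
    unfolding P_def by (simp add: power_add[symmetric] mult.assoc[symmetric] del: mult_pCons_left mult_pCons_right)
  finally show ?case using unit m' m(2) by metis
qed

lemma ex_unit_multiple_monic:
  assumes "map_poly h x \<noteq> 0"
  obtains a where "a dvd 1" "lead_coeff (a * x) = 1" "degree (a * x) = degree (map_poly h x)"
proof -
  obtain a m q where *: "a dvd 1" "lead_coeff m = 1" "degree m = degree (map_poly h x)"
    "a * x = m + [:\<pi>:] ^ Suc r * q"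
    using ex_unit_multiple_monic_mod_power[OF assms] by blast
  then have "a * x = m" by (simp add: poly_nilpotent)
  with * that show thesis by metis
qed

lemma annihilator_poly:
  assumes "[:\<pi>:] ^ (r - 1) * x = 0"
  shows "map_poly h x = 0"
proof (rule poly_eqI)
  fix i
  have "\<pi> ^ (r - 1) * coeff x i = coeff ([:\<pi>:] ^ (r - 1) * x) i"
    by (simp add: poly_const_pow)
  then show "coeff (map_poly h x) i = coeff 0 i" using assms annihilator by simp
qed

text \<open>A relation among the reduced rows lifts to a row combination divisible by \<pi>.
  Multiplied by \<open>\<pi> ^ (r - 1)\<close> it becomes an exact relation, which full rank makes
  trivial, and the annihilator condition gives triviality of the reduced relation.\<close>

lemma ex_minor_nonzero_if_full_row_rank:
  assumes G: "G \<in> carrier_mat k n" and rank: "full_row_rank G"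
  obtains J where "J \<subseteq> {..<n}" "card J = k" "map_poly h (det (submatrix G UNIV J)) \<noteq> 0"
proof -
  let ?G = "map_mat (map_poly h) G"
  have G': "?G \<in> carrier_mat k n" using G by simp
  have "u = 0\<^sub>v k" if u: "u \<in> carrier_vec k" and 0: "transpose_mat ?G *\<^sub>v u = 0\<^sub>v n" for u
  proof -
    define U where "U = vec k (\<lambda>i. SOME x. map_poly h x = u $ i)"
    have U: "map_poly h (U $ i) = u $ i" if "i < k" for i
      using that someI_ex[OF poly.surj] by (simp add: U_def)
    let ?c = "[:\<pi>:] ^ (r - 1)"
    have r: "r \<noteq> 0" using nilpotent by (cases r) auto
    have sum0: "?c * (\<Sum>i = 0..<k. G $$ (i, j) * U $ i) = 0" if j: "j < n" for j
    proof -
      have "map_poly h (\<Sum>i = 0..<k. G $$ (i, j) * U $ i) = (\<Sum>i = 0..<k. ?G $$ (i, j) * u $ i)"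
        using G j U by (simp add: poly.hom_sum poly.hom_mult)
      also have "\<dots> = (transpose_mat ?G *\<^sub>v u) $ j"
        using G j u by (simp add: scalar_prod_def)
      also have "\<dots> = 0" using 0 j by simp
      finally have "[:\<pi>:] dvd (\<Sum>i = 0..<k. G $$ (i, j) * U $ i)" by (simp only: poly.kernel)
      then obtain y where y: "(\<Sum>i = 0..<k. G $$ (i, j) * U $ i) = [:\<pi>:] * y" by (rule dvdE)
      have "?c * ([:\<pi>:] * y) = [:\<pi>:] ^ r * y"
        using power_minus_mult[of r "[:\<pi>:]"] r by (simp only: mult.assoc[symmetric] neq0_conv)
      then show ?thesis unfolding y by (simp only: poly_nilpotent mult_zero_left)
    qed
    define w where "w = vec k (\<lambda>i. fls_of_poly (?c * U $ i))"
    have "encode G w = 0\<^sub>v n"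
    proof (rule eq_vecI)
      fix j assume "j < dim_vec (0\<^sub>v n)"
      then have j: "j < n" by simp
      have "encode G w $ j = (\<Sum>i = 0..<k. fls_of_poly (G $$ (i, j)) * fls_of_poly (?c * U $ i))"
        using G j by (simp add: encode_def scalar_prod_def w_def)
      also have "\<dots> = fls_of_poly (\<Sum>i = 0..<k. ?c * (G $$ (i, j) * U $ i))"
        by (simp add: fls_of_poly_hom.hom_sum fls_of_poly_hom.hom_mult mult.left_commute)
      also have "\<dots> = 0" using sum0[OF j] by (simp add: sum_distrib_left)
      finally show "encode G w $ j = 0\<^sub>v n $ j" using j by simp
    qed (use G in \<open>simp add: encode_def\<close>)
    then have w0: "w = 0\<^sub>v k" using rank G by (auto simp: full_row_rank_def w_def)
    have "u $ i = 0" if i: "i < k" for i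
    proof -
      have "fls_of_poly (?c * U $ i) = w $ i" using i by (simp add: w_def)
      then have "?c * U $ i = 0" using w0 i by simp
      then show ?thesis using annihilator_poly U[OF i] by simp
    qed
    then show ?thesis using u by (intro eq_vecI) auto
  qed
  from ex_nonzero_maximal_minor[OF G' this] obtain J where J: "J \<subseteq> {..<n}" "card J = k"
    "det (submatrix ?G UNIV J) \<noteq> 0" by blast
  then show thesis
    using that by (simp flip: map_mat_submatrix_columns[OF G J(1)])
qed

end

section \<open>Minimal encoders\<close>

lemma transpose_mult_eq_0:
  fixes A B :: "'a::comm_ring_1 mat"
  assumes "A \<in> carrier_mat k n" "B \<in> carrier_mat m n" "A * transpose_mat B = 0\<^sub>m k m"
  shows "B * transpose_mat A = 0\<^sub>m m k"
proof -
  have "B * transpose_mat A = transpose_mat (A * transpose_mat B)"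
    using assms(1,2) by (simp add: transpose_mult[of _ k n _ m])
  then show ?thesis by (simp add: assms(3))
qed

lemma mult_mat_unit_vec_index:
  fixes A :: "'a::comm_ring_1 mat"
  assumes "A \<in> carrier_mat k m" "i < k" "j < m"
  shows "(A *\<^sub>v unit_vec m j) $ i = A $$ (i, j)"
  using assms by (simp add: scalar_prod_right_unit)

lemma generator_matrix_orthogonal:
  fixes G H :: "'a::comm_ring_1 poly mat"
  assumes "generator_matrix k n C G" "generator_matrix m n (dual_code n C) H"
  shows "G * transpose_mat H = 0\<^sub>m k m"
proof -
  let ?G = "map_mat fls_of_poly G" and ?H = "map_mat fls_of_poly H"
  have G: "G \<in> carrier_mat k n" and H: "H \<in> carrier_mat m n"
    and C: "C = row_code G" and D: "dual_code n C = row_code H"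
    using assms by (auto simp: generator_matrix_def)
  have carr: "?G \<in> carrier_mat k n" "?H \<in> carrier_mat m n" using G H by auto
  have prod: "map_mat fls_of_poly (G * transpose_mat H) = ?G * transpose_mat ?H"
    using G H by (simp add: fls_of_poly_hom.mat_hom_mult[of _ k n _ m] map_mat_transpose)
  show ?thesis
  proof (rule eq_matI)
    fix i j assume "i < dim_row (0\<^sub>m k m :: 'a poly mat)" "j < dim_col (0\<^sub>m k m :: 'a poly mat)"
    then have ij: "i < k" "j < m" by simp_all
    have "encode H (unit_vec m j) \<in> dual_code n C"
      unfolding D row_code_def using H by auto
    then have "?G *\<^sub>v (transpose_mat ?H *\<^sub>v unit_vec m j) = 0\<^sub>v k"
      unfolding C dual_code_row_code[OF G] encode_def by simp
    then have "(?G * transpose_mat ?H) *\<^sub>v unit_vec m j = 0\<^sub>v k"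
      using carr by (simp add: assoc_mult_mat_vec[of _ k n _ m])
    moreover have "?G * transpose_mat ?H \<in> carrier_mat k m" using carr by simp
    note mult_mat_unit_vec_index[OF this ij]
    ultimately have "(?G * transpose_mat ?H) $$ (i, j) = 0" using ij by simp
    then have "fls_of_poly ((G * transpose_mat H) $$ (i, j)) = 0"
      unfolding prod[symmetric] using G H ij by (simp del: index_mult_mat(1))
    then show "(G * transpose_mat H) $$ (i, j) = 0\<^sub>m k m $$ (i, j)" using ij by simp
  qed (use G H in auto)
qed

lemma generator_matrix_ex_transition:
  assumes "generator_matrix k n C G" "generator_matrix k n C G'"
  obtains T where "T \<in> carrier_mat k k" "map_mat fls_of_poly G' = T * map_mat fls_of_poly G"
proof -
  let ?G = "map_mat fls_of_poly G" and ?G' = "map_mat fls_of_poly G'"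
  have G: "G \<in> carrier_mat k n" "G' \<in> carrier_mat k n" and C: "row_code G' = row_code G"
    using assms by (auto simp: generator_matrix_def)
  have "\<exists>u\<in>carrier_vec k. encode G' (unit_vec k i) = encode G u" for i
  proof -
    have "encode G' (unit_vec k i) \<in> row_code G'" using G by (auto simp: row_code_def)
    then show ?thesis unfolding C using G by (auto simp: row_code_def)
  qed
  then obtain u where u: "\<And>i. u i \<in> carrier_vec k"
    "\<And>i. encode G' (unit_vec k i) = encode G (u i)" by metis
  define T where "T = mat k k (\<lambda>(i, l). u i $ l)"
  have T: "T \<in> carrier_mat k k" by (simp add: T_def)
  have "?G' = T * ?G"
  proof (rule eq_matI)
    fix i j assume "i < dim_row (T * ?G)" "j < dim_col (T * ?G)"
    then have ij: "i < k" "j < n" using T G by auto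
    have "?G' $$ (i, j) = encode G' (unit_vec k i) $ j"
      using G ij by (simp add: encode_def scalar_prod_right_unit[of _ k])
    also have "\<dots> = (T * ?G) $$ (i, j)"
      unfolding u(2) using G ij u(1)[of i]
      by (auto simp: encode_def T_def scalar_prod_def mult.commute intro!: sum.cong)
    finally show "?G' $$ (i, j) = (T * ?G) $$ (i, j)" .
  qed (use G T in auto)
  with T show thesis by (rule that)
qed

lemma generator_matrix_minor_transition:
  assumes "generator_matrix k n C G" "generator_matrix k n C G'"
  shows "\<exists>t. \<forall>J. J \<subseteq> {..<n} \<longrightarrow> card J = k \<longrightarrow>
    fls_of_poly (det (submatrix G' UNIV J)) = t * fls_of_poly (det (submatrix G UNIV J))"
proof -
  obtain T where T: "T \<in> carrier_mat k k" "map_mat fls_of_poly G' = T * map_mat fls_of_poly G"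
    using generator_matrix_ex_transition[OF assms] .
  have G: "G \<in> carrier_mat k n" "G' \<in> carrier_mat k n"
    using assms by (auto simp: generator_matrix_def)
  show ?thesis
  proof (intro exI allI impI)
    fix J assume J: "J \<subseteq> {..<n}" "card J = k"
    have G': "map_mat fls_of_poly G \<in> carrier_mat k n" using G by simp
    have "submatrix (map_mat fls_of_poly G) UNIV J \<in> carrier_mat k k"
      using submatrix_columns_carrier[OF G' J(1)] J(2) by simp
    then have "det (submatrix (map_mat fls_of_poly G') UNIV J) =
        det T * det (submatrix (map_mat fls_of_poly G) UNIV J)"
      unfolding T(2) submatrix_columns_mult[OF T(1) G' J(1)] using T(1) by (simp add: det_mult)
    then show "fls_of_poly (det (submatrix G' UNIV J)) = det T * fls_of_poly (det (submatrix G UNIV J))"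
      by (simp flip: map_mat_submatrix_columns[OF G(1) J(1)] map_mat_submatrix_columns[OF G(2) J(1)])
  qed
qed

text \<open>The factor between the minors of two encoders is one Laurent series for all column sets;
  cross multiplication cancels it and leaves an identity of polynomials.\<close>

lemma generator_matrix_minors_proportional:
  assumes "generator_matrix k n C G" "generator_matrix k n C G'"
    and J: "J \<subseteq> {..<n}" "card J = k" and K: "K \<subseteq> {..<n}" "card K = k"
  shows "det (submatrix G' UNIV K) * det (submatrix G UNIV J) =
    det (submatrix G UNIV K) * det (submatrix G' UNIV J)"
proof -
  obtain t where t: "\<And>J. J \<subseteq> {..<n} \<Longrightarrow> card J = k \<Longrightarrow>
    fls_of_poly (det (submatrix G' UNIV J)) = t * fls_of_poly (det (submatrix G UNIV J))"
    using generator_matrix_minor_transition[OF assms(1,2)] by auto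
  have "fls_of_poly (det (submatrix G' UNIV K) * det (submatrix G UNIV J)) =
      fls_of_poly (det (submatrix G UNIV K) * det (submatrix G' UNIV J))"
    unfolding fls_of_poly_hom.hom_mult t[OF J] t[OF K] by (simp only: ac_simps)
  then show ?thesis by simp
qed

section \<open>Gcds of maximal minors\<close>

lemma finite_maximal_minors: "finite (maximal_minors G)"
proof -
  have "maximal_minors G \<subseteq> (\<lambda>J. det (submatrix G UNIV J)) ` Pow {..<dim_col G}"
    by (auto simp: maximal_minors_def)
  then show ?thesis by (rule finite_subset) simp
qed

text \<open>Divisibility at one column set spreads to all: in the relation between complementary
  minors the nonzero \<open>J\<close>-minor cancels, so every maximal minor of \<open>G\<close>
  divides the complementary minor of \<open>H\<close>.\<close>

lemma Gcd_maximal_minors_dvd: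
  fixes G H :: "'a::{idom, semiring_Gcd} mat"
  assumes G: "G \<in> carrier_mat k n" and H: "H \<in> carrier_mat m n" and n: "k + m = n"
    and GH: "G * transpose_mat H = 0\<^sub>m k m"
    and J: "J \<subseteq> {..<n}" "card J = k"
    and dvd: "det (submatrix G UNIV J) dvd det (submatrix H UNIV ({..<n} - J))"
    and nz: "det (submatrix G UNIV J) \<noteq> 0"
  shows "Gcd (maximal_minors G) dvd Gcd (maximal_minors H)"
proof (rule Gcd_greatest)
  fix x assume "x \<in> maximal_minors H"
  then obtain K where K: "K \<subseteq> {..<n}" "card K = m" "x = det (submatrix H UNIV K)"
    using H by (auto simp: maximal_minors_def)
  define I where "I = {..<n} - K"
  have finK: "finite K" using K finite_subset by blast
  have I: "I \<subseteq> {..<n}" "card I = k" "{..<n} - I = K"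
    using K n finK by (auto simp: I_def card_Diff_subset)
  have "Gcd (maximal_minors G) dvd det (submatrix G UNIV I)"
    using G I by (intro Gcd_dvd) (auto simp: maximal_minors_def)
  also have "det (submatrix G UNIV I) dvd x"
  proof -
    obtain e where e: "det (submatrix H UNIV ({..<n} - J)) = det (submatrix G UNIV J) * e"
      using dvd by (elim dvdE)
    obtain s where s: "s \<in> {1, -1}" "det (submatrix G UNIV I) * det (submatrix H UNIV ({..<n} - J)) =
        s * (det (submatrix G UNIV J) * x)"
      using complementary_minors[OF G H n GH J I(1,2)] unfolding I(3) K(3) by blast
    have "det (submatrix G UNIV J) * (det (submatrix G UNIV I) * e) = det (submatrix G UNIV J) * (s * x)"
      using s(2) unfolding e by (simp only: ac_simps)
    then have "det (submatrix G UNIV I) * e = s * x" using nz by simp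
    then have "det (submatrix G UNIV I) dvd s * x" by (metis dvd_triv_left)
    then show ?thesis using s(1) by auto
  qed
  finally show "Gcd (maximal_minors G) dvd x" .
qed

section \<open>Residual degrees of minors of encoders\<close>

context nilpotent_reduction
begin

abbreviation residual_minor :: "nat set \<Rightarrow> 'a poly mat \<Rightarrow> 'b poly" where
  "residual_minor J G \<equiv> map_poly h (det (submatrix G UNIV J))"

lemma residual_minor_eq:
  assumes "G \<in> carrier_mat k n" "J \<subseteq> {..<n}"
  shows "residual_minor J G = det (submatrix (map_mat (map_poly h) G) UNIV J)"
  by (simp flip: map_mat_submatrix_columns[OF assms])

text \<open>Conversely, a polynomial in the kernel is nilpotent, hence no unit. Nonvanishing modulo
  \<pi> can thus be followed through transformations over Laurent series, that is, from one encoder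
  to another.\<close>

lemma fls_of_poly_unit_iff: "fls_of_poly x dvd 1 \<longleftrightarrow> map_poly h x \<noteq> 0"
proof
  assume unit: "fls_of_poly x dvd 1"
  show "map_poly h x \<noteq> 0"
  proof
    assume "map_poly h x = 0"
    then obtain y where y: "x = [:\<pi>:] * y" using poly.kernel by (metis dvdE)
    have "x ^ r = 0" unfolding y power_mult_distrib poly_nilpotent by simp
    then have "fls_of_poly x ^ r = 0" by (simp flip: fls_of_poly_hom.hom_power)
    moreover have "fls_of_poly x ^ r dvd 1 ^ r" using unit by (rule dvd_power_same)
    ultimately show False by simp
  qed
qed (rule fls_of_poly_unit)

text \<open>The second conclusion presents the code of \<open>G\<close> as a dual: any other matrix
  orthogonal to \<open>H\<close> with nonzero residual \<open>J\<close>-minor then encodes the same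
  code.\<close>

lemma generator_matrix_dual:
  assumes G: "G \<in> carrier_mat k n" and H: "H \<in> carrier_mat m n" and n: "k + m = n"
    and GH: "G * transpose_mat H = 0\<^sub>m k m"
    and J: "J \<subseteq> {..<n}" "card J = k"
    and nz: "residual_minor J G \<noteq> 0" "residual_minor ({..<n} - J) H \<noteq> 0"
  shows "generator_matrix m n (dual_code n (row_code G)) H"
    and "generator_matrix k n (dual_code n (row_code H)) G"
proof -
  have finJ: "finite J" using J finite_subset by blast
  have c: "{..<n} - J \<subseteq> {..<n}" "card ({..<n} - J) = m" "{..<n} - ({..<n} - J) = J"
    using J n finJ by (auto simp: card_Diff_subset)
  show "generator_matrix m n (dual_code n (row_code G)) H"
    using generator_matrix_dual_code[OF G H GH J c(2)] nz by (simp add: fls_of_poly_unit_iff)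
  show "generator_matrix k n (dual_code n (row_code H)) G"
    using generator_matrix_dual_code[OF H G transpose_mult_eq_0[OF G H GH] c(1,2)] c(3) J nz
    by (simp add: fls_of_poly_unit_iff)
qed

lemma residual_minor_nonzero_transfer:
  assumes "generator_matrix k n C G" "generator_matrix k n C G'"
    and J: "J \<subseteq> {..<n}" "card J = k" and nz: "residual_minor J G \<noteq> 0"
  shows "residual_minor J G' \<noteq> 0"
proof -
  obtain t where "fls_of_poly (det (submatrix G UNIV J)) = t * fls_of_poly (det (submatrix G' UNIV J))"
    using generator_matrix_minor_transition[OF assms(2,1)] J by metis
  then have "fls_of_poly (det (submatrix G' UNIV J)) dvd fls_of_poly (det (submatrix G UNIV J))"
    by simp
  then show ?thesis using nz unfolding fls_of_poly_unit_iff[symmetric] by (rule dvd_trans)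
qed

text \<open>A detour through duality replaces inverting \<open>D\<close> over Laurent series:
  \<open>G\<close> and \<open>D * G\<close> are orthogonal to the same \<open>H\<close>, so both
  encode the dual of \<open>row_code H\<close>.\<close>

lemma generator_matrix_left_mult:
  assumes gen: "generator_matrix k n C G" and J: "J \<subseteq> {..<n}" "card J = k"
    and nz: "residual_minor J G \<noteq> 0"
    and D: "D \<in> carrier_mat k k" "map_poly h (det D) \<noteq> 0"
  shows "generator_matrix k n C (D * G)"
proof -
  have G: "G \<in> carrier_mat k n" and C: "C = row_code G" using gen by (auto simp: generator_matrix_def)
  have "k \<le> n" using J card_mono[of "{..<n}" J] by simp
  then have n: "k + (n - k) = n" by simp
  obtain H where H: "H \<in> carrier_mat (n - k) n" "G * transpose_mat H = 0\<^sub>m k (n - k)"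
    "residual_minor ({..<n} - J) H dvd residual_minor J G"
    using poly.ex_orthogonal_with_dvd_minor[OF poly_nilpotent G J] .
  have nzH: "residual_minor ({..<n} - J) H \<noteq> 0" using H(3) nz by auto
  have DG: "D * G \<in> carrier_mat k n" using D G by simp
  have DGH: "D * G * transpose_mat H = 0\<^sub>m k (n - k)"
    using D G H by (simp add: assoc_mult_mat[of _ k k _ n _ "n - k"])
  have "submatrix G UNIV J \<in> carrier_mat k k" using submatrix_columns_carrier[OF G J(1)] J by simp
  then have "residual_minor J (D * G) \<noteq> 0"
    unfolding submatrix_columns_mult[OF D(1) G J(1)] using D nz
    by (simp add: det_mult[of _ k] poly.hom_mult)
  then have "generator_matrix k n (dual_code n (row_code H)) (D * G)"
    using generator_matrix_dual(2)[OF DG H(1) n DGH J] nzH by simp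
  moreover have "dual_code n (row_code H) = C"
    using generator_matrix_dual(2)[OF G H(1) n H(2) J nz nzH] C by (simp add: generator_matrix_def)
  ultimately show ?thesis by simp
qed

text \<open>If another encoder \<open>G'\<close> had a \<open>J\<close>-minor of smaller residual degree, scale a row of it by a
  unit so that the \<open>J\<close>-minors of both become the same unit multiple of monic polynomials;
  proportionality of the minors then makes every minor of \<open>G'\<close> of smaller degree than that of \<open>G\<close>.\<close>

lemma RIDM_residual_minor_minimal:
  assumes ridm: "RIDM k n C G" and gen': "generator_matrix k n C G'"
    and J: "J \<subseteq> {..<n}" "card J = k" and nz: "residual_minor J G \<noteq> 0"
  shows "degree (residual_minor J G) \<le> degree (residual_minor J G')"
proof (rule ccontr)
  have gen: "generator_matrix k n C G" using ridm by (simp add: RIDM_def)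
  have G: "G \<in> carrier_mat k n" and G': "G' \<in> carrier_mat k n"
    using gen gen' by (auto simp: generator_matrix_def)
  have nz': "residual_minor J G' \<noteq> 0"
    using residual_minor_nonzero_transfer[OF gen gen' J nz] .
  let ?d = "degree (residual_minor J G)" and ?d' = "degree (residual_minor J G')"
  assume "\<not> ?d \<le> ?d'"
  then have less: "?d' < ?d" by simp
  let ?m = "\<lambda>G K. det (submatrix G UNIV K) :: 'a poly"
  \<comment> \<open>Row 0 is going to be scaled. Without rows the minor is the empty determinant 1,
    whose degree 0 cannot exceed \<open>?d'\<close>.\<close>
  have k: "0 < k"
  proof (rule ccontr)
    assume "\<not> 0 < k"
    then have "submatrix G UNIV J \<in> carrier_mat 0 0"
      using submatrix_columns_carrier[OF G J(1)] J by simp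
    then show False using less by simp
  qed
  obtain a where a: "a dvd 1" "lead_coeff (a * ?m G J) = 1" "degree (a * ?m G J) = ?d"
    using ex_unit_multiple_monic[OF nz] .
  obtain a' where a': "a' dvd 1" "lead_coeff (a' * ?m G' J) = 1" "degree (a' * ?m G' J) = ?d'"
    using ex_unit_multiple_monic[OF nz'] .
  obtain b where b: "a * b = 1" using a(1) by (metis dvdE)
  \<comment> \<open>Since \<open>b\<close> is inverse to \<open>a\<close>, this makes
    \<open>a\<close> times the \<open>J\<close>-minor of \<open>D * G'\<close> equal to the monic
    \<open>a' * ?m G' J\<close>.\<close>
  define u where "u = b * a'"
  define D where "D = multrow_mat k 0 u"
  have D: "D \<in> carrier_mat k k" "det D = u" using k by (simp_all add: D_def det_multrow_mat)
  have "b dvd 1" using b by (metis dvdI mult.commute)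
  then have "u dvd 1" unfolding u_def using a'(1) by (metis mult_dvd_mono mult_1)
  then have "map_poly h u dvd 1" by (metis poly.hom_dvd poly.hom_one)
  then have "map_poly h u \<noteq> 0" by auto
  then have gen'': "generator_matrix k n C (D * G')"
    using generator_matrix_left_mult[OF gen' J nz' D(1)] D(2) by simp
  have minor'': "?m (D * G') K = u * ?m G' K" if "K \<subseteq> {..<n}" "card K = k" for K
    unfolding submatrix_columns_mult[OF D(1) G' that(1)]
    using D submatrix_columns_carrier[OF G' that(1)] that(2) by (simp add: det_mult[of _ k])
  have degJ: "?d \<le> degree (?m G J)" by (rule degree_map_poly_le)
  have fin: "finite (degree ` maximal_minors G)" for G :: "'a poly mat"
    by (intro finite_imageI finite_maximal_minors)
  have le_internal: "degree (?m G K) \<le> internal_degree G" if "K \<subseteq> {..<n}" "card K = k" for K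
    unfolding internal_degree_def using that G fin
    by (intro Max_ge) (auto simp: maximal_minors_def)
  have "degree (?m (D * G') K) < internal_degree G" if K: "K \<subseteq> {..<n}" "card K = k" for K
  proof (cases "?m (D * G') K = 0")
    case True
    then show ?thesis using less degJ le_internal[OF J] by simp
  next
    case False
    have "?m (D * G') K * ?m G J = ?m G K * ?m (D * G') J"
      by (rule generator_matrix_minors_proportional[OF gen gen'' J K])
    then have "a * (?m (D * G') K * ?m G J) = a * (?m G K * (b * a' * ?m G' J))"
      unfolding minor''[OF J] u_def by (simp only:)
    also have "\<dots> = (a * b) * (?m G K * (a' * ?m G' J))" by (simp only: ac_simps)
    finally have eq: "?m (D * G') K * (a * ?m G J) = ?m G K * (a' * ?m G' J)"
      unfolding b by (simp add: ac_simps)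
    \<comment> \<open>With zero divisors around, degrees add here only because
      \<open>a * ?m G J\<close> is monic; for the other side of \<open>eq\<close> the general upper
      bound is enough.\<close>
    have "degree (?m (D * G') K) + ?d \<le> degree (?m (D * G') K * (a * ?m G J))"
    proof (rule le_degree)
      show "coeff (?m (D * G') K * (a * ?m G J)) (degree (?m (D * G') K) + ?d) \<noteq> 0"
        using coeff_mult_degree_sum[of "?m (D * G') K" "a * ?m G J"] a False by simp
    qed
    also have "\<dots> \<le> degree (?m G K) + ?d'"
      unfolding eq using degree_mult_le[of "?m G K" "a' * ?m G' J"] a' by simp
    finally show ?thesis using less le_internal[OF K] by simp
  qed
  then have "internal_degree (D * G') < internal_degree G"
    unfolding internal_degree_def[of "D * G'"] using D G' J fin
    by (subst Max_less_iff) (auto simp: maximal_minors_def)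
  then show False using ridm gen'' by (auto simp: RIDM_def)
qed

text \<open>\<open>H'\<close> has a minor dividing that of \<open>G\<close>, and \<open>H''\<close>
  one dividing those of both \<open>H\<close> and \<open>H'\<close>. Minimality of \<open>H\<close>
  makes the minors of \<open>H\<close> and \<open>H''\<close> associated, so the divisibility passes
  from \<open>H'\<close> to \<open>H\<close>.\<close>

lemma minimal_residual_minor_dvd:
  assumes gen: "generator_matrix k n C G" and genH: "generator_matrix (n - k) n (dual_code n C) H"
    and J: "J \<subseteq> {..<n}" "card J = k"
    and nz: "residual_minor J G \<noteq> 0" "residual_minor ({..<n} - J) H \<noteq> 0"
    and minimal: "\<And>H'. generator_matrix (n - k) n (dual_code n C) H' \<Longrightarrow>
      degree (residual_minor ({..<n} - J) H) \<le> degree (residual_minor ({..<n} - J) H')"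
  shows "residual_minor ({..<n} - J) H dvd residual_minor J G"
proof -
  let ?c = "{..<n} - J"
  have finJ: "finite J" using J finite_subset by blast
  have "k \<le> n" using J card_mono[of "{..<n}" J] by simp
  then have n: "k + (n - k) = n" by simp
  have c: "?c \<subseteq> {..<n}" "card ?c = n - k" using J finJ by (auto simp: card_Diff_subset)
  have G: "G \<in> carrier_mat k n" and C: "C = row_code G" using gen by (auto simp: generator_matrix_def)
  have H: "H \<in> carrier_mat (n - k) n" using genH by (simp add: generator_matrix_def)
  have GH: "G * transpose_mat H = 0\<^sub>m k (n - k)" by (rule generator_matrix_orthogonal[OF gen genH])
  obtain H' where H': "H' \<in> carrier_mat (n - k) n" "G * transpose_mat H' = 0\<^sub>m k (n - k)"
    "residual_minor ?c H' dvd residual_minor J G"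
    using poly.ex_orthogonal_with_dvd_minor[OF poly_nilpotent G J] .
  obtain H'' where H'': "H'' \<in> carrier_mat (n - k) n" "G * transpose_mat H'' = 0\<^sub>m k (n - k)"
    "residual_minor ?c H'' dvd residual_minor ?c H" "residual_minor ?c H'' dvd residual_minor ?c H'"
    using poly.ex_orthogonal_with_common_divisor_minor[OF G c H GH H'(1,2)] .
  have nz'': "residual_minor ?c H'' \<noteq> 0" using H''(3) nz(2) by auto
  then have "generator_matrix (n - k) n (dual_code n C) H''"
    unfolding C using generator_matrix_dual(1)[OF G H''(1) n H''(2) J nz(1)] by simp
  then have le: "degree (residual_minor ?c H) \<le> degree (residual_minor ?c H'')" by (rule minimal)
  obtain q where q: "residual_minor ?c H = residual_minor ?c H'' * q" using H''(3) by (elim dvdE)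
  then have "q \<noteq> 0" using nz(2) by auto
  then have "degree q = 0" using le nz'' unfolding q by (simp add: degree_mult_eq)
  then have "q dvd 1" using \<open>q \<noteq> 0\<close> by (simp add: is_unit_iff_degree)
  then have "residual_minor ?c H dvd residual_minor ?c H''"
    unfolding q by (metis mult_dvd_mono dvd_refl mult_1_right)
  also note H''(4)
  also note H'(3)
  finally show ?thesis .
qed

end

section \<open>Reduction modulo a prime\<close>

lemma of_int_mod_ring_eq_0_iff:
  "(of_int i :: 'q::nontriv mod_ring) = 0 \<longleftrightarrow> int CARD('q) dvd i"
  unfolding of_int_of_int_mod_ring by transfer (simp add: dvd_eq_mod_eq_0)

lemma of_int_to_int_mod_ring: "of_int (to_int_mod_ring a) = (a :: 'q::nontriv mod_ring)"
  by (simp add: of_int_of_int_mod_ring)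

lemma mod_ring_ex_of_int: "\<exists>i. a = of_int i" for a :: "'a::nontriv mod_ring"
  using of_int_to_int_mod_ring[of a] by metis

lemma reduce_mod_of_int:
  assumes "CARD('p::prime_card) dvd CARD('q::nontriv)"
  shows "reduce_mod (of_int i :: 'q mod_ring) = (of_int i :: 'p mod_ring)"
proof -
  let ?j = "to_int_mod_ring (of_int i :: 'q mod_ring)"
  have "(of_int (?j - i) :: 'q mod_ring) = 0" by (simp add: of_int_to_int_mod_ring)
  then have "int CARD('q) dvd ?j - i" by (simp only: of_int_mod_ring_eq_0_iff)
  then have "int CARD('p) dvd ?j - i" using assms by (meson dvd_trans int_dvd_int_iff)
  then have "(of_int (?j - i) :: 'p mod_ring) = 0" by (simp only: of_int_mod_ring_eq_0_iff)
  then show ?thesis by (simp add: reduce_mod_def flip: of_int_of_int_mod_ring)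
qed

text \<open>The conditions on elements are checked on integer representatives, where they turn into
  divisibility by \<open>p\<close>; for the annihilator, \<open>p ^ r\<close> dividing
  \<open>p ^ (r - 1) * i\<close> forces \<open>p\<close> to divide \<open>i\<close>.\<close>

lemma nilpotent_reduction_reduce_mod:
  assumes p: "CARD('p::prime_card) = p" and q: "CARD('q::nontriv) = p ^ r" and r: "r \<ge> 1"
  shows "nilpotent_reduction (reduce_mod :: 'q mod_ring \<Rightarrow> 'p mod_ring) (of_nat p) r"
proof -
  let ?h = "reduce_mod :: 'q mod_ring \<Rightarrow> 'p mod_ring"
  have "CARD('p) dvd CARD('q)" unfolding p q using r by (simp add: dvd_power)
  note h = reduce_mod_of_int[OF this]
  have zero: "?h (of_int i) = 0 \<longleftrightarrow> int p dvd i" for i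
    by (simp add: h of_int_mod_ring_eq_0_iff p)
  have pos: "p > 0" using p by (metis prime_card prime_gt_0_nat)
  show ?thesis
  proof unfold_locales
    show "?h 0 = 0" "?h 1 = 1" using h[of 0] h[of 1] by simp_all
    fix x y :: "'q mod_ring"
    obtain i j where ij: "x = of_int i" "y = of_int j" using mod_ring_ex_of_int by blast
    show "?h (x + y) = ?h x + ?h y" unfolding ij using h[of "i + j"] by (simp add: h)
    show "?h (x * y) = ?h x * ?h y" unfolding ij using h[of "i * j"] by (simp add: h)
    show "?h x = 0 \<longleftrightarrow> of_nat p dvd x"
    proof
      assume "?h x = 0"
      then obtain l where "i = int p * l" unfolding ij zero by (elim dvdE)
      then have "x = of_nat p * of_int l" by (simp add: ij)
      then show "of_nat p dvd x" by (rule dvdI)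
    next
      assume "of_nat p dvd x"
      then obtain z where z: "x = of_nat p * z" by (elim dvdE)
      obtain l where "z = of_int l" using mod_ring_ex_of_int by blast
      then have "x = of_int (int p * l)" by (simp add: z)
      then show "?h x = 0" by (simp only: zero dvd_triv_left)
    qed
    show "?h x = 0" if x: "of_nat p ^ (r - 1) * x = 0"
    proof -
      have "(of_int (int p ^ (r - 1) * i) :: 'q mod_ring) = 0" using x by (simp add: ij)
      then have "int p ^ r dvd int p ^ (r - 1) * i" by (simp only: of_int_mod_ring_eq_0_iff q of_nat_power)
      moreover have "int p ^ r = int p ^ (r - 1) * int p" using r by (metis One_nat_def Suc_le_lessD power_minus_mult)
      ultimately have "int p dvd i" using pos by simp
      then show ?thesis by (simp only: ij zero)
    qed
  next
    show "\<exists>x. ?h x = y" for y using mod_ring_ex_of_int[of y] h by metis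
    have "(of_int (int p ^ r) :: 'q mod_ring) = 0" unfolding of_int_mod_ring_eq_0_iff q by simp
    then show "(of_nat p :: 'q mod_ring) ^ r = 0" by simp
  qed
qed

section \<open>RIDMs of a code and of its dual\<close>

lemma ex_RIDM:
  assumes "generator_matrix k n C G"
  obtains G' where "RIDM k n C G'"
  using ex_has_least_nat[of "generator_matrix k n C" G internal_degree] assms
  by (auto simp: RIDM_def)

text \<open>As \<open>G\<close> and \<open>H\<close> are arbitrary RIDMs, this also yields
  independence of the choice: two RIDMs of a code both agree with one RIDM of the dual.\<close>

lemma Delta_matrix_dual:
  fixes C :: "'q::nontriv mod_ring fls vec set"
  assumes p: "CARD('p::prime_card) = p" and q: "CARD('q) = p ^ r" and r: "r \<ge> 1"
    and ridm: "RIDM k n C G" and ridmH: "RIDM (n - k) n (dual_code n C) H"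
  shows "(Delta_matrix G :: 'p mod_ring poly) = Delta_matrix H"
proof -
  interpret nilpotent_reduction "reduce_mod :: 'q mod_ring \<Rightarrow> 'p mod_ring" "of_nat p" r
    using p q r by (rule nilpotent_reduction_reduce_mod)
  let ?h = "map_poly (reduce_mod :: 'q mod_ring \<Rightarrow> 'p mod_ring)"
  let ?G = "map_mat ?h G" and ?H = "map_mat ?h H"
  have gen: "generator_matrix k n C G" and genH: "generator_matrix (n - k) n (dual_code n C) H"
    using ridm ridmH by (auto simp: RIDM_def)
  have G: "G \<in> carrier_mat k n" and C: "C = row_code G" and H: "H \<in> carrier_mat (n - k) n"
    using gen genH by (auto simp: generator_matrix_def)
  have carr: "?G \<in> carrier_mat k n" "?H \<in> carrier_mat (n - k) n" using G H by auto
  obtain J where J: "J \<subseteq> {..<n}" "card J = k" and nz: "residual_minor J G \<noteq> 0"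
    using ex_minor_nonzero_if_full_row_rank[OF G] gen by (auto simp: generator_matrix_def)
  obtain K where K: "K \<subseteq> {..<n}" "card K = n - k" and nzK: "residual_minor K H \<noteq> 0"
    using ex_minor_nonzero_if_full_row_rank[OF H] genH by (auto simp: generator_matrix_def)
  let ?c = "{..<n} - J"
  have "k \<le> n" using J card_mono[of "{..<n}" J] by simp
  then have n: "k + (n - k) = n" "n - k + k = n" "n - (n - k) = k" by simp_all
  have fin: "finite J" "finite K" using J K finite_subset by blast+
  have c: "?c \<subseteq> {..<n}" "card ?c = n - k" "{..<n} - ?c = J"
    "{..<n} - K \<subseteq> {..<n}" "card ({..<n} - K) = k" "{..<n} - ({..<n} - K) = K"
    using J K fin n by (auto simp: card_Diff_subset)
  have GH: "G * transpose_mat H = 0\<^sub>m k (n - k)" by (rule generator_matrix_orthogonal[OF gen genH])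
  have GH': "?G * transpose_mat ?H = 0\<^sub>m k (n - k)"
  proof -
    have "?G * transpose_mat ?H = map_mat ?h (G * transpose_mat H)"
      using G H by (simp add: poly.mat_hom_mult[of _ k n _ "n - k"] map_mat_transpose)
    then show ?thesis using GH by (auto intro: eq_matI)
  qed
  \<comment> \<open>\<open>J\<close> was found from \<open>G\<close> and \<open>K\<close> from
    \<open>H\<close>. The minors of \<open>G\<close> on \<open>J\<close> and of \<open>H\<close> on
    \<open>K\<close> have a nonzero product, so by complementary minors the complement of
    \<open>J\<close> works for \<open>H\<close> too.\<close>
  have nzH: "residual_minor ?c H \<noteq> 0"
  proof
    assume 0: "residual_minor ?c H = 0"
    obtain s where "s \<in> {1, -1}" "det (submatrix ?G UNIV ({..<n} - K)) * det (submatrix ?H UNIV ?c) =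
        s * (det (submatrix ?G UNIV J) * det (submatrix ?H UNIV K))"
      using complementary_minors[OF carr n(1) GH' J c(4,5)] unfolding c(6) by blast
    then show False
      using 0 nz nzK by (auto simp: residual_minor_eq[OF G J(1)] residual_minor_eq[OF H c(1)]
        residual_minor_eq[OF H K(1)])
  qed
  \<comment> \<open>\<open>H\<close> encodes the dual of \<open>C\<close> and \<open>G\<close> the
    dual of that code; this lets \<open>G\<close> and \<open>H\<close> exchange roles below.\<close>
  have double_dual: "dual_code n (dual_code n C) = C"
    using generator_matrix_dual[OF G H n(1) GH J nz nzH] C by (simp add: generator_matrix_def)
  have 1: "residual_minor ?c H dvd residual_minor J G"
    using gen genH J nz nzH RIDM_residual_minor_minimal[OF ridmH _ c(1,2) nzH]
    by (rule minimal_residual_minor_dvd)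
  have 2: "residual_minor J G dvd residual_minor ?c H"
    using minimal_residual_minor_dvd[OF genH, of G ?c] gen c nz nzH
      RIDM_residual_minor_minimal[OF ridm _ J nz] unfolding double_dual n(3) by simp
  note minors = residual_minor_eq[OF G J(1)] residual_minor_eq[OF H c(1)]
  have "Gcd (maximal_minors ?G) dvd Gcd (maximal_minors ?H)"
    using Gcd_maximal_minors_dvd[OF carr n(1) GH' J] 2 nz unfolding minors by simp
  moreover have "Gcd (maximal_minors ?H) dvd Gcd (maximal_minors ?G)"
    using Gcd_maximal_minors_dvd[OF carr(2,1) n(2) transpose_mult_eq_0[OF carr GH'] c(1,2)] 1 nzH c(3)
    unfolding minors by simp
  ultimately show ?thesis
    unfolding Delta_matrix_def reduce_mat_def by (rule associated_eqI) simp_all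
qed

theorem theorem4p1:
  fixes p r k n :: nat
    and C :: "'q::nontriv mod_ring fls vec set"
  assumes "prime p" and "r \<ge> 1"
    and "CARD('p::prime_card) = p" and "CARD('q) = p ^ r"
    and "free_convolutional_code k n C"
  shows "(Delta_code k n C :: 'p mod_ring poly) = Delta_code (n - k) n (dual_code n C)"
proof -
  interpret nilpotent_reduction "reduce_mod :: 'q mod_ring \<Rightarrow> 'p mod_ring" "of_nat p" r
    using assms by (intro nilpotent_reduction_reduce_mod)
  obtain G0 where gen: "generator_matrix k n C G0"
    using assms(5) by (auto simp: free_convolutional_code_def)
  then have G0: "G0 \<in> carrier_mat k n" and C: "C = row_code G0" and "full_row_rank G0"
    by (auto simp: generator_matrix_def)
  then obtain J where J: "J \<subseteq> {..<n}" "card J = k" and nz: "residual_minor J G0 \<noteq> 0"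
    using ex_minor_nonzero_if_full_row_rank by blast
  have "k \<le> n" using J card_mono[of "{..<n}" J] by simp
  then have n: "k + (n - k) = n" by simp
  \<comment> \<open>The dual must have an encoder, and hence a RIDM, for the description of its
    residual polynomial to have a witness.\<close>
  obtain H0 where H0: "H0 \<in> carrier_mat (n - k) n" "G0 * transpose_mat H0 = 0\<^sub>m k (n - k)"
    "residual_minor ({..<n} - J) H0 dvd residual_minor J G0"
    using poly.ex_orthogonal_with_dvd_minor[OF poly_nilpotent G0 J] .
  then have "residual_minor ({..<n} - J) H0 \<noteq> 0" using nz by auto
  then have "generator_matrix (n - k) n (dual_code n C) H0"
    unfolding C using generator_matrix_dual(1)[OF G0 H0(1) n H0(2) J nz] by simp
  then obtain H where H: "RIDM (n - k) n (dual_code n C) H" by (rule ex_RIDM)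
  obtain G where G: "RIDM k n C G" using gen by (rule ex_RIDM)
  note eq = Delta_matrix_dual[OF assms(3,4,2)]
  have "(Delta_code k n C :: 'p mod_ring poly) = Delta_matrix G"
    unfolding Delta_code_def
  proof (rule the_equality)
    show "\<exists>G'. RIDM k n C G' \<and> Delta_matrix G = Delta_matrix G'" using G by blast
    fix d :: "'p mod_ring poly" assume "\<exists>G'. RIDM k n C G' \<and> d = Delta_matrix G'"
    then show "d = Delta_matrix G" using eq[OF _ H] G by metis
  qed
  also have "\<dots> = Delta_matrix H" using G H by (rule eq)
  also have "\<dots> = Delta_code (n - k) n (dual_code n C)"
    unfolding Delta_code_def
  proof (rule the_equality[symmetric])
    show "\<exists>H'. RIDM (n - k) n (dual_code n C) H' \<and> Delta_matrix H = Delta_matrix H'" using H by blast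
    fix d :: "'p mod_ring poly"
    assume "\<exists>H'. RIDM (n - k) n (dual_code n C) H' \<and> d = Delta_matrix H'"
    then show "d = Delta_matrix H" using eq[OF G] H by metis
  qed
  finally show ?thesis .
qed

end
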